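(* Let $\Gamma=XStrip$ be the graph with 8 vertices $t_0,t_1,t_2,t_3,b_0,b_1,b_2,b_3$ and the 14 edges $$t_0t_1,\ t_1t_2,\ t_2t_3,\ b_0b_1,\ b_1b_2,\ b_2b_3,\ t_0b_0,\ t_1b_1,\ t_2b_2,\ t_3b_3,\ t_0b_2,\ b_0t_2,\ t_1b_3,\ b_1t_3 .$$ Then the function $F_\Gamma: q\mapsto \# X_\Gamma(\mathbb{F}_q)$, defined on the set of prime powers, is not a polynomial; that is, there is no polynomial $P\in\mathbb{Z}[q]$ such that $F_\Gamma(q)=P(q)$ for all prime powers $q$.
   Context: For a connected graph $\Gamma$ with edge set $E$, the graph polynomial is $\Psi_\Gamma=\sum_T\prod_{e\notin T}A_e\in\mathbb{Z}[A_e\mid e\in E]$, where the sum runs over all spanning trees $T$ of $\Gamma$ and the $A_e$ are variables indexed by the edges. The (affine) graph hypersurface $X_\Gamma\subset\mathbb{A}^{|E|}_{\mathbb{Z}}$ is the vanishing locus of $\Psi_\Gamma$. Thus $\#X_\Gamma(\mathbb{F}_q)$ is the number of points $a\in\mathbb{F}_q^{E}$ with $\Psi_\Gamma(a)=0$. Equivalently, after an invertible integral linear change of variables, $X_\Gamma$ for $\Gamma=XStrip$ is the hypersurface in $\mathbb{A}^{14}$ with coordinates $A_0,\ldots,A_6,B_0,\ldots,B_6$ given by the vanishing of the determinant of $$\begin{pmatrix} B_0 & A_0 & A_2 & A_1 & 0 & 0 & A_1\\ A_0 & B_1 & A_2+A_3 & A_3 & 0 & A_3 & A_3\\ A_2 &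 A_2+A_3 & B_2 & A_3-A_4 & A_4 & A_3 & A_3\\ A_1 & A_3 & A_3-A_4 & B_3 & A_4 & A_3 & A_3-A_1\\ 0 & 0 & A_4 & A_4 & B_4 & A_5 & A_6\\ 0 & A_3 & A_3 & A_3 & A_5 & B_5 & A_3+A_6\\ A_1 & A_3 & A_3 & A_3-A_1 & A_6 & A_3+A_6 & B_6 \end{pmatrix}.$$ *)

theory Defs
  imports
    "HOL-Library.FuncSet"
    "HOL-Library.Poly_Mapping"
    "HOL-Algebra.Ring"
    "HOL-Computational_Algebra.Polynomial"
    "HOL-Number_Theory.Prime_Powers"
begin

section \<open>Spanning trees of finite simple graphs\<close>

text \<open>A graph is given by its vertex set and its set of edges, each edge being the two-element
  set of its end points.\<close>

definition graph_connected :: "'v set \<Rightarrow> 'v set set \<Rightarrow> bool" where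
  "graph_connected V E \<longleftrightarrow> (\<forall>u\<in>V. \<forall>v\<in>V. (u, v) \<in> {(x, y). {x, y} \<in> E}\<^sup>*)"

definition graph_cycle :: "'v set set \<Rightarrow> 'v list \<Rightarrow> bool" where
  "graph_cycle E vs \<longleftrightarrow> length vs \<ge> 3 \<and> distinct vs \<and>
     (\<forall>i < length vs. {vs ! i, vs ! (Suc i mod length vs)} \<in> E)"

definition spanning_trees :: "'v set \<Rightarrow> 'v set set \<Rightarrow> 'v set set set" where
  "spanning_trees V E = {T. T \<subseteq> E \<and> graph_connected V T \<and> (\<nexists>vs. graph_cycle T vs)}"


section \<open>The graph polynomial\<close>

text \<open>Polynomials with integer coefficients in variables indexed by \<open>'e\<close>: finitely supported maps
  from monomials (finitely supported exponent vectors) to the integers; multiplication is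
  convolution.\<close>

type_synonym 'e int_mpoly = "('e \<Rightarrow>\<^sub>0 nat) \<Rightarrow>\<^sub>0 int"

definition mvar :: "'e \<Rightarrow> 'e int_mpoly" where
  "mvar e = Poly_Mapping.single (Poly_Mapping.single e 1) 1"

definition graph_poly :: "'v set \<Rightarrow> 'v set set \<Rightarrow> 'v set int_mpoly" where
  "graph_poly V E = (\<Sum>T\<in>spanning_trees V E. \<Prod>e\<in>E - T. mvar e)"

definition mpoly_eval :: "('a, 'm) ring_scheme \<Rightarrow> ('e \<Rightarrow> 'a) \<Rightarrow> 'e int_mpoly \<Rightarrow> 'a" where
  "mpoly_eval K a f =
     (\<Oplus>\<^bsub>K\<^esub> m\<in>Poly_Mapping.keys f. [Poly_Mapping.lookup f m] \<cdot>\<^bsub>K\<^esub>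
        (\<Otimes>\<^bsub>K\<^esub> e\<in>Poly_Mapping.keys m. a e [^]\<^bsub>K\<^esub> Poly_Mapping.lookup m e))"

text \<open>The \<open>K\<close>-rational points of the affine graph hypersurface in the affine space with
  coordinates indexed by \<open>E\<close>.\<close>

definition graph_hypersurface ::
    "('a, 'm) ring_scheme \<Rightarrow> 'v set \<Rightarrow> 'v set set \<Rightarrow> ('v set \<Rightarrow> 'a) set" where
  "graph_hypersurface K V E =
     {a \<in> E \<rightarrow>\<^sub>E carrier K. mpoly_eval K a (graph_poly V E) = \<zero>\<^bsub>K\<^esub>}"

text \<open>For a prime power \<open>q\<close> there is, up to isomorphism, exactly one field with \<open>q\<close> elements, and
  being finite it has a copy whose carrier consists of integers. The number of points below does
  not depend on the copy chosen; for other \<open>q\<close> the value is irrelevant.\<close>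

definition GF :: "nat \<Rightarrow> int ring" where
  "GF q = (SOME K. field K \<and> finite (carrier K) \<and> card (carrier K) = q)"

definition point_count :: "'v set \<Rightarrow> 'v set set \<Rightarrow> nat \<Rightarrow> nat" where
  "point_count V E q = card (graph_hypersurface (GF q) V E)"


section \<open>The graph XStrip\<close>

datatype xstrip_vertex = T0 | T1 | T2 | T3 | B0 | B1 | B2 | B3

definition xstrip_edges :: "xstrip_vertex set set" where
  "xstrip_edges =
     {{T0, T1}, {T1, T2}, {T2, T3}, {B0, B1}, {B1, B2}, {B2, B3},
      {T0, B0}, {T1, B1}, {T2, B2}, {T3, B3},
      {T0, B2}, {B0, T2}, {T1, B3}, {B1, T3}}"


section \<open>Evaluating the graph polynomial\<close>

lemma prod_mvar:
  assumes "finite S"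
  shows "(\<Prod>e\<in>S. mvar e) =
    Poly_Mapping.single (\<Sum>e\<in>S. Poly_Mapping.single e (1::nat)) (1::int)"
  using assms by (induction S) (auto simp: mvar_def mult_single)

lemma lookup_sum_single:
  assumes "finite S"
  shows "Poly_Mapping.lookup (\<Sum>e\<in>S. Poly_Mapping.single e (1::nat)) x = (if x \<in> S then 1 else 0)"
  using assms by (induction S) (auto simp: lookup_add lookup_single when_def)

lemma mpoly_eval_graph_poly:
  fixes K (structure) and V :: "'v set"
  assumes "cring K" and "finite E" and a: "a \<in> E \<rightarrow> carrier K"
  shows "mpoly_eval K a (graph_poly V E) =
    (\<Oplus>T\<in>spanning_trees V E. \<Otimes>e\<in>E - T. a e)"
proof -
  interpret cring K by fact
  define S where "S = spanning_trees V E"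
  define mon :: "'v set set \<Rightarrow> 'v set \<Rightarrow>\<^sub>0 nat"
    where "mon T = (\<Sum>e\<in>E - T. Poly_Mapping.single e 1)" for T
  have sub: "T \<subseteq> E" if "T \<in> S" for T using that by (auto simp: S_def spanning_trees_def)
  have finS: "finite S" by (rule finite_subset[of _ "Pow E"]) (use sub assms(2) in auto)
  have lk: "Poly_Mapping.lookup (mon T) x = (if x \<in> E - T then 1 else 0)" for T x
    unfolding mon_def by (rule lookup_sum_single) (use assms(2) in simp)
  have keys_mon: "Poly_Mapping.keys (mon T) = E - T" for T
    by (auto simp: in_keys_iff lk split: if_splits)
  have inj: "inj_on mon S"
  proof (rule inj_onI)
    fix T U assume "T \<in> S" "U \<in> S" "mon T = mon U"
    then show "T = U" using keys_mon[of T] keys_mon[of U] sub[of T] sub[of U] by auto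
  qed
  have gp: "graph_poly V E = (\<Sum>T\<in>S. Poly_Mapping.single (mon T) 1)"
    unfolding graph_poly_def S_def[symmetric] mon_def
    using assms(2) by (intro sum.cong refl prod_mvar) auto
  have lkp: "Poly_Mapping.lookup (graph_poly V E) m = (if m \<in> mon ` S then 1 else 0)" for m
  proof -
    have "Poly_Mapping.lookup (graph_poly V E) m = (\<Sum>T\<in>S. if mon T = m then 1 else 0)"
      unfolding gp by (simp add: lookup_sum lookup_single when_def eq_commute)
    also have "\<dots> = (\<Sum>m'\<in>mon ` S. if m' = m then 1 else 0)"
      by (subst sum.reindex[OF inj]) simp
    also have "\<dots> = (if m \<in> mon ` S then 1 else 0)" using finS by simp
    finally show ?thesis .
  qed
  have keys_p: "Poly_Mapping.keys (graph_poly V E) = mon ` S"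
    by (auto simp: in_keys_iff lkp split: if_splits)
  have summand: "(\<Otimes>e\<in>Poly_Mapping.keys (mon T). a e [^] Poly_Mapping.lookup (mon T) e)
      = (\<Otimes>e\<in>E - T. a e)" for T
    unfolding keys_mon by (rule finprod_cong') (use a in \<open>auto simp: lk Pi_iff\<close>)
  have cl: "(\<Otimes>e\<in>E - T. a e) \<in> carrier K" for T
    by (rule finprod_closed) (use a in \<open>auto simp: Pi_iff\<close>)
  have "mpoly_eval K a (graph_poly V E) =
      (\<Oplus>m\<in>mon ` S. (\<Otimes>e\<in>Poly_Mapping.keys m. a e [^] Poly_Mapping.lookup m e))"
    unfolding mpoly_eval_def keys_p
    by (rule finsum_cong') (use cl in \<open>auto simp: lkp summand add_pow_int_ge\<close>)
  also have "\<dots> = (\<Oplus>T\<in>S. (\<Otimes>e\<in>Poly_Mapping.keys (mon T). a e [^] Poly_Mapping.lookup (mon T) e))"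
    by (rule finsum_reindex) (use inj cl in \<open>auto simp: summand\<close>)
  finally show ?thesis by (simp add: summand S_def)
qed

end

theory Submission
  imports Defs "HOL-Number_Theory.Residues" "HOL-Library.Transitive_Closure_Table"
begin

text \<open>
  Only the number of points modulo \<open>p^3\<close> over prime fields is needed. It is congruent to \<open>- p^2\<close>
  for every odd prime \<open>p\<close>, but to \<open>0\<close> for \<open>p = 2\<close> (\<open>point_count_xstrip_cong\<close>). If the count were
  a polynomial \<open>P\<close> with integer coefficients, the odd primes would force the coefficients of \<open>1\<close>,
  \<open>q\<close> and \<open>q^2\<close> in \<open>P\<close> to be \<open>0\<close>, \<open>0\<close> and \<open>- 1\<close>, and then \<open>P(2)\<close> would be congruent to \<open>- 4\<close>
  modulo \<open>8\<close>.

  The graph is a four-cycle with corners \<open>T1, T2, B2, B1\<close> to which two copies of one gadget are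
  attached: two adjacent vertices, one joined to the corners \<open>T1, B2\<close>, the other to the opposite
  pair \<open>T2, B1\<close>. In the basis of loops that close the gadget through the corners, the five edge
  variables of a gadget become the five free entries of a symmetric \<open>3\<times>3\<close> matrix
  \<open>D\<close> with \<open>D12 = 0\<close>. If the rest of the graph has polynomial \<open>K\<close> and resistance matrix \<open>S = N / K\<close>
  between the corners, the graph polynomial is \<open>K * det (D + S)\<close>, a polynomial in \<open>D\<close> whose
  coefficients are \<open>K\<close>, the entries of \<open>N\<close>, and the minors of \<open>N\<close> divided by powers of \<open>K\<close>.

  For fixed \<open>K\<close>, \<open>N\<close> the number of \<open>D\<close> at which this vanishes is elementary: modulo \<open>p^3\<close> it is
  \<open>- p^2\<close> if \<open>K \<noteq> 0\<close> and \<open>N12 = 0\<close>, and \<open>0\<close> otherwise (\<open>gadget_sum_pencil\<close>). If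
  \<open>K \<noteq> 0\<close>, a translation of \<open>D\<close> leads to symmetric matrices with a prescribed entry \<open>N12\<close>; if
  \<open>K = 0\<close>, the matrix \<open>N\<close> has rank at most one and the polynomial is invariant under enough
  translations. So it remains to count, modulo \<open>p\<close>, the points of the four-cycle with the second
  gadget at which \<open>K \<noteq> 0\<close> and \<open>N12 = 0\<close>. Both \<open>K\<close> and \<open>N12\<close> are linear in the edge inside that
  gadget, and their resultant splits into two factors that are linear in two further
  variables. Eliminating these leaves the condition \<open>e1 * e3 \<noteq> 0\<close> on the four edges of the
  cycle, where \<open>e1, e3\<close> are elementary symmetric polynomials (\<open>count_gadget\<close>). On the hyperplane
  \<open>e1 = 0\<close> the surface \<open>e3 = 0\<close> is the union of three planes \<open>z1 + z2 = 0\<close>,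
  \<open>z1 + z3 = 0\<close>, \<open>z2 + z3 = 0\<close>. Their equations are independent in odd characteristic but add
  up to zero in characteristic two, and this is where the two cases part (\<open>count_cycle\<close>).

  Three further ingredients connect this with the definitions: deletion and contraction of edges
  evaluates the sum over spanning trees, a field with \<open>p\<close> elements is the image of the integers,
  and the number of zeros is an iterated sum of indicator functions over \<open>{0..<p}\<close>.
\<close>

section \<open>Counting zeros modulo a prime\<close>

definition zero_ind :: "int \<Rightarrow> int \<Rightarrow> int" where
  "zero_ind p x = of_bool (p dvd x)"

lemma zero_ind_cong: "[x = y] (mod p) \<Longrightarrow> zero_ind p x = zero_ind p y"
  by (simp add: zero_ind_def cong_dvd_iff)

lemma zero_ind_cong_0: "p dvd x - y \<Longrightarrow> zero_ind p x = zero_ind p y"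
  by (rule zero_ind_cong) (simp add: cong_iff_dvd_diff)

lemma zero_ind_dvd: "p dvd x \<Longrightarrow> zero_ind p x = 1" and zero_ind_not_dvd: "\<not> p dvd x \<Longrightarrow> zero_ind p x = 0"
  by (simp_all add: zero_ind_def)

text \<open>Used as introduction rules, these replace the variables of a polynomial expression by congruent
  ones.\<close>

lemmas cong_poly = cong_refl cong_add cong_mult cong_diff cong_pow

text \<open>Affine substitutions leave the set \<open>{0..<p}\<close>. They are harmless under the sum sign for functions
  of the residue class of their argument.\<close>

definition periodic_mod :: "int \<Rightarrow> (int \<Rightarrow> int) \<Rightarrow> bool" where
  "periodic_mod p g \<longleftrightarrow> (\<forall>x y. [x = y] (mod p) \<longrightarrow> g x = g y)"

lemma periodic_modD: "periodic_mod p g \<Longrightarrow> [x = y] (mod p) \<Longrightarrow> g x = g y"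
  by (simp add: periodic_mod_def)

locale prime_modulus =
  fixes p :: int
  assumes p: "prime p"
begin

lemma p_pos: "0 < p" and p_nonneg: "0 \<le> p"
  using prime_gt_0_int[OF p] by simp_all

lemma sum_const_residues: "(\<Sum>x\<in>{0..<p}. c) = p * c" for c :: int
  using p_nonneg by simp

lemma cong_sum_0: "[(\<Sum>x\<in>{0..<p}. c) = 0] (mod p)" for c :: int
  by (simp add: sum_const_residues cong_0_iff)

lemma p_dvd_mult_iff: "p dvd a * b \<longleftrightarrow> p dvd a \<or> p dvd b"
  using p by (rule prime_dvd_mult_iff)

lemma p_dvd_square_iff: "p dvd a\<^sup>2 \<longleftrightarrow> p dvd a"
  by (simp add: power2_eq_square p_dvd_mult_iff)

text \<open>Inclusion and exclusion for the union of two hypersurfaces. It is one of three rules by which all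
  counting modulo \<open>p\<close> is done; the others are \<open>count_linear_cong\<close> and \<open>count_two_linear_cong\<close>.\<close>

lemma zero_ind_mult: "zero_ind p (a * b) = zero_ind p a + zero_ind p b - zero_ind p a * zero_ind p b"
  by (auto simp: zero_ind_def p_dvd_mult_iff)

lemma inverse_mod_p:
  assumes "\<not> p dvd a"
  obtains i where "[a * i = 1] (mod p)"
proof -
  have "coprime a p"
    using assms p by (metis coprime_commute prime_imp_coprime)
  then show ?thesis using cong_solve_coprime_int that by blast
qed

lemma sum_affine_subst:
  assumes g: "periodic_mod p g" and k: "\<not> p dvd k"
  shows "(\<Sum>x\<in>{0..<p}. g (k * x + c)) = (\<Sum>x\<in>{0..<p}. g x)"
proof -
  have "inj_on (\<lambda>x. (k * x + c) mod p) {0..<p}"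
  proof (rule inj_onI)
    fix x y assume x: "x \<in> {0..<p}" and y: "y \<in> {0..<p}"
      and "(k * x + c) mod p = (k * y + c) mod p"
    then have "p dvd (k * x + c) - (k * y + c)" by (simp add: mod_eq_dvd_iff)
    then have "p dvd k * (x - y)" by (simp add: algebra_simps)
    then have "p dvd x - y" using k by (simp add: p_dvd_mult_iff)
    then have "x mod p = y mod p" by (simp add: mod_eq_dvd_iff)
    then show "x = y" using x y by simp
  qed
  moreover have "(\<lambda>x. (k * x + c) mod p) ` {0..<p} \<subseteq> {0..<p}"
    using p_pos by auto
  ultimately have "bij_betw (\<lambda>x. (k * x + c) mod p) {0..<p} {0..<p}"
    by (simp add: bij_betw_def endo_inj_surj)
  then have "(\<Sum>x\<in>{0..<p}. g x) = (\<Sum>x\<in>{0..<p}. g ((k * x + c) mod p))"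
    by (rule sum.reindex_bij_betw[symmetric])
  also have "\<dots> = (\<Sum>x\<in>{0..<p}. g (k * x + c))"
    by (intro sum.cong refl periodic_modD[OF g]) simp
  finally show ?thesis by simp
qed

lemma sum_shift:
  assumes "periodic_mod p g"
  shows "(\<Sum>x\<in>{0..<p}. g (x + c)) = (\<Sum>x\<in>{0..<p}. g x)"
proof -
  have "\<not> p dvd 1" using p not_prime_unit by blast
  from sum_affine_subst[OF assms this, of c] show ?thesis by (simp only: mult_1_left)
qed

lemma sum_uminus:
  assumes "periodic_mod p g"
  shows "(\<Sum>x\<in>{0..<p}. g (- x)) = (\<Sum>x\<in>{0..<p}. g x)"
proof -
  have "\<not> p dvd - 1" using p not_prime_unit by auto
  from sum_affine_subst[OF assms this, of 0] show ?thesis by simp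
qed

lemma count_linear:
  assumes "\<not> p dvd a"
  shows "(\<Sum>x\<in>{0..<p}. zero_ind p (a * x + b)) = 1"
proof -
  have "(\<Sum>x\<in>{0..<p}. zero_ind p (a * x + b)) = (\<Sum>x\<in>{0..<p}. zero_ind p x)"
    using assms by (intro sum_affine_subst) (simp_all add: periodic_mod_def zero_ind_cong)
  also have "\<dots> = (\<Sum>x\<in>{0..<p}. if x = 0 then 1 else 0)"
    by (intro sum.cong refl) (simp add: zero_ind_def zdvd_not_zless)
  finally show ?thesis using p_pos by simp
qed

lemma count_linear_degenerate:
  assumes "p dvd a"
  shows "(\<Sum>x\<in>{0..<p}. zero_ind p (a * x + b)) = p * zero_ind p b"
proof -
  have "zero_ind p (a * x + b) = zero_ind p b" for x
    using assms by (intro zero_ind_cong_0) simp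
  then show ?thesis using p_nonneg by simp
qed

text \<open>A linear equation has one solution unless its leading coefficient vanishes, and then the number
  of solutions is a multiple of \<open>p\<close>.\<close>

lemma count_linear_cong: "[(\<Sum>x\<in>{0..<p}. zero_ind p (a * x + b)) = 1 - zero_ind p a] (mod p)"
proof (cases "p dvd a")
  case True then show ?thesis by (simp add: count_linear_degenerate zero_ind_dvd cong_0_iff)
next
  case False then show ?thesis by (simp add: count_linear zero_ind_not_dvd)
qed

text \<open>Two linear equations in one unknown have a common solution when their resultant vanishes.\<close>

lemma count_two_linear_cong:
  "[(\<Sum>x\<in>{0..<p}. zero_ind p (a * x + b) * zero_ind p (c * x + d)) = zero_ind p (a * d - b * c) - zero_ind p a * zero_ind p c] (mod p)"
proof -
  have *: "(\<Sum>x\<in>{0..<p}. zero_ind p (a * x + b) * zero_ind p (c * x + d)) = zero_ind p (a * d - b * c)"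
    if "\<not> p dvd a" for a b c d
  proof -
    have "zero_ind p (a * x + b) * zero_ind p (c * x + d) = zero_ind p (a * x + b) * zero_ind p (a * d - b * c)" for x
    proof (cases "p dvd a * x + b")
      case True
      have "a * (c * x + d) - (a * d - b * c) = c * (a * x + b)" by (simp add: algebra_simps)
      then have "zero_ind p (a * (c * x + d)) = zero_ind p (a * d - b * c)"
        using True by (intro zero_ind_cong_0) simp
      then show ?thesis using that by (simp add: zero_ind_def p_dvd_mult_iff)
    qed (simp add: zero_ind_not_dvd)
    then have "(\<Sum>x\<in>{0..<p}. zero_ind p (a * x + b) * zero_ind p (c * x + d))
        = (\<Sum>x\<in>{0..<p}. zero_ind p (a * x + b)) * zero_ind p (a * d - b * c)"
      by (simp only: sum_distrib_right)
    then show ?thesis by (simp only: count_linear[OF that] mult_1_left)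
  qed
  consider "\<not> p dvd a" | "\<not> p dvd c" "p dvd a" | "p dvd a" "p dvd c" by blast
  then show ?thesis
  proof cases
    case 1 then show ?thesis by (simp add: * zero_ind_not_dvd)
  next
    case 2
    have "(\<Sum>x\<in>{0..<p}. zero_ind p (a * x + b) * zero_ind p (c * x + d))
        = (\<Sum>x\<in>{0..<p}. zero_ind p (c * x + d) * zero_ind p (a * x + b))"
      by (simp only: mult.commute)
    also have "\<dots> = zero_ind p (c * b - d * a)" by (rule *[OF 2(1)])
    also have "\<dots> = zero_ind p (a * d - b * c) - zero_ind p a * zero_ind p c"
      using dvd_diff_commute[of p "c * b" "d * a"] 2(1) by (simp add: zero_ind_def mult.commute)
    finally show ?thesis by (simp only: cong_refl)
  next
    case 3
    have "zero_ind p (a * x + b) * zero_ind p (c * x + d) = zero_ind p b * zero_ind p d" for x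
      using 3 by (simp add: zero_ind_def dvd_add_right_iff)
    moreover have "zero_ind p (a * d - b * c) - zero_ind p a * zero_ind p c = 0"
      using 3 by (simp add: zero_ind_dvd)
    ultimately show ?thesis using cong_sum_0 by (simp only:)
  qed
qed

lemma count_one_linear_cong: "[(\<Sum>x\<in>{0..<p}. zero_ind p (x + b)) = 1] (mod p)"
proof -
  have "zero_ind p 1 = 0" using p not_prime_unit by (auto simp: zero_ind_def)
  then show ?thesis using count_linear_cong[of 1 b] by simp
qed

lemma count_two_monic_cong:
  "[(\<Sum>x\<in>{0..<p}. zero_ind p (a * x + b) * zero_ind p (x + d)) = zero_ind p (a * d - b)] (mod p)"
proof -
  have "zero_ind p 1 = 0" using p not_prime_unit by (auto simp: zero_ind_def)
  then show ?thesis using count_two_linear_cong[of a b 1 d] by simp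
qed

end

section \<open>Pencils of symmetric matrices\<close>

type_synonym sym3 = "int \<times> int \<times> int \<times> int \<times> int \<times> int"

text \<open>A symmetric \<open>3\<times>3\<close> matrix is the list of its entries 11, 22, 33, 12, 13, 23. The pairing below
  is the trace of the product.\<close>

fun adj3 :: "sym3 \<Rightarrow> sym3" where
  "adj3 (a, b, c, d, e, f) =
     (b * c - f * f, a * c - e * e, a * b - d * d, e * f - d * c, d * f - e * b, d * e - a * f)"

fun det3 :: "sym3 \<Rightarrow> int" where
  "det3 (a, b, c, d, e, f) = a * b * c + 2 * d * e * f - a * f * f - b * e * e - c * d * d"

fun pair3 :: "sym3 \<Rightarrow> sym3 \<Rightarrow> int" where
  "pair3 (a, b, c, d, e, f) (a', b', c', d', e', f') =
     a * a' + b * b' + c * c' + 2 * (d * d' + e * e' + f * f')"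

fun add3 :: "sym3 \<Rightarrow> sym3 \<Rightarrow> sym3" where
  "add3 (a, b, c, d, e, f) (a', b', c', d', e', f') = (a + a', b + b', c + c', d + d', e + e', f + f')"

fun scale3 :: "int \<Rightarrow> sym3 \<Rightarrow> sym3" where
  "scale3 k (a, b, c, d, e, f) = (k * a, k * b, k * c, k * d, k * e, k * f)"

text \<open>For \<open>K \<noteq> 0\<close>, \<open>N = K * S\<close>, \<open>M = K * adj S\<close> and \<open>T = K * det S\<close> this is \<open>K * det (D + S)\<close>. With the
  four coefficients as separate parameters it also makes sense for \<open>K = 0\<close>.\<close>

definition pencil :: "int \<Rightarrow> sym3 \<Rightarrow> sym3 \<Rightarrow> int \<Rightarrow> sym3 \<Rightarrow> int" where
  "pencil K N M T D = K * det3 D + pair3 N (adj3 D) + pair3 M D + T"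

text \<open>The relations \<open>K M = adj N\<close> and \<open>N M = K T\<close> (times the identity matrix), which hold for the
  coefficients of \<open>K * det (D + S)\<close>. Where \<open>K\<close> is a unit, they determine \<open>M\<close> and \<open>T\<close> from \<open>N\<close>. Where
  \<open>K = 0\<close>, they say that \<open>N\<close> has rank at most one and annihilates \<open>M\<close>.\<close>

fun coherent :: "int \<Rightarrow> sym3 \<Rightarrow> sym3 \<Rightarrow> int \<Rightarrow> bool" where
  "coherent K (a, b, c, d, e, f) (a', b', c', d', e', f') T \<longleftrightarrow>
     scale3 K (a', b', c', d', e', f') = adj3 (a, b, c, d, e, f) \<and>
     a * a' + d * d' + e * e' = K * T \<and> a * d' + d * b' + e * f' = 0 \<and> a * e' + d * f' + e * c' = 0 \<and>
     d * a' + b * d' + f * e' = 0 \<and> d * d' + b * b' + f * f' = K * T \<and> d * e' + b * f' + f * c' = 0 \<and>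
     e * a' + f * d' + c * e' = 0 \<and> e * d' + f * b' + c * f' = 0 \<and> e * e' + f * f' + c * c' = K * T"

definition periodic5_mod :: "int \<Rightarrow> (int \<Rightarrow> int \<Rightarrow> int \<Rightarrow> int \<Rightarrow> int \<Rightarrow> int) \<Rightarrow> bool" where
  "periodic5_mod p G \<longleftrightarrow> (\<forall>u u' v v' s s' t t' y y'.
     [u = u'] (mod p) \<longrightarrow> [v = v'] (mod p) \<longrightarrow> [s = s'] (mod p) \<longrightarrow> [t = t'] (mod p) \<longrightarrow> [y = y'] (mod p) \<longrightarrow>
     G u v s t y = G u' v' s' t' y')"

lemma periodic5_modD:
  "periodic5_mod p G \<Longrightarrow> [u = u'] (mod p) \<Longrightarrow> [v = v'] (mod p) \<Longrightarrow> [s = s'] (mod p) \<Longrightarrow>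
   [t = t'] (mod p) \<Longrightarrow> [y = y'] (mod p) \<Longrightarrow> G u v s t y = G u' v' s' t' y'"
  unfolding periodic5_mod_def by blast

lemma periodic5_mod_zero_ind_pencil: "periodic5_mod p (\<lambda>u v s t y. zero_ind p (pencil K N M T (u, v, y, d, s, t)))"
  unfolding periodic5_mod_def pencil_def
  by (cases N; cases M) (auto intro!: zero_ind_cong cong_poly)

text \<open>If \<open>K = 0\<close> and \<open>a = N11\<close> is a unit modulo \<open>p\<close>, then \<open>N = a n n^t\<close> with \<open>n = (1, g, h)\<close>,
  and \<open>M n = 0\<close>. The pencil then depends on \<open>D\<close>
  only through the restriction of the quadratic form \<open>D\<close> to the orthogonal complement of \<open>n\<close>. The
  shifts of \<open>v, y, t\<close> by multiples of \<open>u, s\<close> pass to the coordinates of this restriction.\<close>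

lemma pencil_rank_one_shift:
  assumes coh: "coherent K (a, b, c, d, e, f) (a', b', c', d', e', f') T"
    and K: "p dvd K" and i: "[a * i = 1] (mod p)"
  defines "g \<equiv> i * d" and "h \<equiv> i * e"
  shows "[pencil K (a, b, c, d, e, f) (a', b', c', d', e', f') T
            (u, v - g\<^sup>2 * u, y + 2 * h * s - h\<^sup>2 * u, 0, s, t + g * s - g * h * u)
        = a * (v * y - t\<^sup>2) + b' * v + 2 * f' * t + c' * y + T] (mod p)"
proof -
  obtain r where r: "K = p * r" using K by auto
  obtain k where "a * i - 1 = p * k" using i by (auto simp: cong_iff_dvd_diff elim: dvdE)
  then have k: "a * i = 1 + p * k" by simp
  have rel: "p * r * b' = a * c - e * e" "p * r * c' = a * b - d * d"
      "p * r * e' = d * f - e * b" "p * r * d' = e * f - d * c" "p * r * f' = d * e - a * f"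
      "a * a' + d * d' + e * e' = p * r * T" "a * d' + d * b' + e * f' = 0" "a * e' + d * f' + e * c' = 0"
    using coh by (simp_all add: r)
  have d: "[d = a * g] (mod p)" and e: "[e = a * h] (mod p)"
    unfolding cong_iff_dvd_diff g_def h_def using k by Groebner_Basis.algebra+
  have b: "[b = a * g\<^sup>2] (mod p)"
    unfolding cong_iff_dvd_diff g_def h_def using k rel(2) by Groebner_Basis.algebra
  have c: "[c = a * h\<^sup>2] (mod p)"
    unfolding cong_iff_dvd_diff g_def h_def using k rel(1) by Groebner_Basis.algebra
  have f: "[f = a * g * h] (mod p)"
    unfolding cong_iff_dvd_diff g_def h_def using k rel(3,4,5) by Groebner_Basis.algebra
  have e': "[e' = - g * f' - h * c'] (mod p)"
    unfolding cong_iff_dvd_diff g_def h_def using k rel(8) by Groebner_Basis.algebra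
  have a': "[a' = g\<^sup>2 * b' + 2 * g * h * f' + h\<^sup>2 * c'] (mod p)"
    unfolding cong_iff_dvd_diff g_def h_def using k rel(6-8) by Groebner_Basis.algebra
  have K0: "[K = 0] (mod p)" using K by (simp add: cong_0_iff)
  have "[pencil K (a, b, c, d, e, f) (a', b', c', d', e', f') T (U, V, Y, 0, S, W)
      = pencil 0 (a, a * g\<^sup>2, a * h\<^sup>2, a * g, a * h, a * g * h)
          (g\<^sup>2 * b' + 2 * g * h * f' + h\<^sup>2 * c', b', c', d', - g * f' - h * c', f') T
          (U, V, Y, 0, S, W)] (mod p)" for U V Y S W
    unfolding pencil_def det3.simps adj3.simps pair3.simps
    by (intro cong_poly a' b c d e e' f K0)
  moreover have "pencil 0 (a, a * g\<^sup>2, a * h\<^sup>2, a * g, a * h, a * g * h)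
          (g\<^sup>2 * b' + 2 * g * h * f' + h\<^sup>2 * c', b', c', d', - g * f' - h * c', f') T
          (u, v - g\<^sup>2 * u, y + 2 * h * s - h\<^sup>2 * u, 0, s, t + g * s - g * h * u)
        = a * (v * y - t\<^sup>2) + b' * v + 2 * f' * t + c' * y + T"
    unfolding pencil_def det3.simps adj3.simps pair3.simps by Groebner_Basis.algebra
  ultimately show ?thesis by metis
qed

section \<open>Summation over the variables of a gadget\<close>

context prime_modulus
begin

text \<open>The matrices \<open>D\<close> of gadgets are \<open>(u, v, y, 0, s, t)\<close> with five free entries.\<close>

abbreviation gadget_sum :: "(int \<Rightarrow> int \<Rightarrow> int \<Rightarrow> int \<Rightarrow> int \<Rightarrow> int) \<Rightarrow> int" where
  "gadget_sum G \<equiv> (\<Sum>u\<in>{0..<p}. \<Sum>v\<in>{0..<p}. \<Sum>s\<in>{0..<p}. \<Sum>t\<in>{0..<p}. \<Sum>y\<in>{0..<p}. G u v s t y)"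

lemma gadget_sum_affine:
  assumes G: "periodic5_mod p G" and k: "\<not> p dvd k"
  shows "gadget_sum (\<lambda>u v s t y. G (k * u + c1) (k * v + c2) (k * s + c3) (k * t + c4) (k * y + c5)) = gadget_sum G"
proof -
  note per = allI impI refl sum.cong periodic5_modD[OF G] cong_refl
  have "gadget_sum (\<lambda>u v s t y. G (k * u + c1) (k * v + c2) (k * s + c3) (k * t + c4) (k * y + c5))
      = gadget_sum (\<lambda>u v s t y. G (k * u + c1) (k * v + c2) (k * s + c3) (k * t + c4) y)"
    by (intro sum.cong refl sum_affine_subst[OF _ k]) (unfold periodic_mod_def, intro per; assumption)
  also have "\<dots> = gadget_sum (\<lambda>u v s t y. G (k * u + c1) (k * v + c2) (k * s + c3) t y)"
    by (intro sum.cong refl sum_affine_subst[OF _ k, where g = "\<lambda>t. \<Sum>y\<in>_. G _ _ _ t y"])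
      (unfold periodic_mod_def, intro per; assumption)
  also have "\<dots> = gadget_sum (\<lambda>u v s t y. G (k * u + c1) (k * v + c2) s t y)"
    by (intro sum.cong refl sum_affine_subst[OF _ k, where g = "\<lambda>s. \<Sum>t\<in>_. \<Sum>y\<in>_. G _ _ s t y"])
      (unfold periodic_mod_def, intro per; assumption)
  also have "\<dots> = gadget_sum (\<lambda>u v s t y. G (k * u + c1) v s t y)"
    by (intro sum.cong refl sum_affine_subst[OF _ k, where g = "\<lambda>v. \<Sum>s\<in>_. \<Sum>t\<in>_. \<Sum>y\<in>_. G _ v s t y"])
      (unfold periodic_mod_def, intro per; assumption)
  also have "\<dots> = gadget_sum G"
    by (intro sum_affine_subst[OF _ k, where g = "\<lambda>u. \<Sum>v\<in>_. \<Sum>s\<in>_. \<Sum>t\<in>_. \<Sum>y\<in>_. G u v s t y"])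
      (unfold periodic_mod_def, intro per; assumption)
  finally show ?thesis .
qed

text \<open>Here \<open>x1, x3\<close> and \<open>a, b\<close> are the edges that join the two gadget vertices to their corners, and
  \<open>x0\<close> is the edge between them. The entries of \<open>D\<close> are the sums of edge variables along the loops
  (diagonal) and along their common parts (off the diagonal, with a sign for the orientation). Each
  entry contains a variable that the previous ones do not, so the substitution is triangular.\<close>

lemma gadget_sum_edges:
  assumes G: "periodic5_mod p G"
  shows "(\<Sum>x1\<in>{0..<p}. \<Sum>a\<in>{0..<p}. \<Sum>x3\<in>{0..<p}. \<Sum>b\<in>{0..<p}. \<Sum>x0\<in>{0..<p}.
      G (x1 + x3) (a + b) x1 (- a) (x0 + x1 + a)) = gadget_sum G"
proof -
  note per = allI impI refl sum.cong periodic5_modD[OF G] cong_refl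
  have "(\<Sum>x1\<in>{0..<p}. \<Sum>a\<in>{0..<p}. \<Sum>x3\<in>{0..<p}. \<Sum>b\<in>{0..<p}. \<Sum>x0\<in>{0..<p}.
      G (x1 + x3) (a + b) x1 (- a) (x0 + x1 + a))
    = (\<Sum>x1\<in>{0..<p}. \<Sum>a\<in>{0..<p}. \<Sum>x3\<in>{0..<p}. \<Sum>b\<in>{0..<p}. \<Sum>x0\<in>{0..<p}.
      G (x3 + x1) (b + a) x1 (- a) (x0 + (x1 + a)))"
    by (simp only: ac_simps)
  also have "\<dots> = (\<Sum>x1\<in>{0..<p}. \<Sum>a\<in>{0..<p}. \<Sum>x3\<in>{0..<p}. \<Sum>b\<in>{0..<p}. \<Sum>y\<in>{0..<p}.
      G (x3 + x1) (b + a) x1 (- a) y)"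
    by (intro sum.cong refl sum_shift) (unfold periodic_mod_def, intro per; assumption)
  also have "\<dots> = (\<Sum>x1\<in>{0..<p}. \<Sum>a\<in>{0..<p}. \<Sum>x3\<in>{0..<p}. \<Sum>v\<in>{0..<p}. \<Sum>y\<in>{0..<p}.
      G (x3 + x1) v x1 (- a) y)"
    by (intro sum.cong refl sum_shift[where g = "\<lambda>v. \<Sum>y\<in>_. G _ v _ _ y"])
      (unfold periodic_mod_def, intro per; assumption)
  also have "\<dots> = (\<Sum>s\<in>{0..<p}. \<Sum>a\<in>{0..<p}. \<Sum>u\<in>{0..<p}. \<Sum>v\<in>{0..<p}. \<Sum>y\<in>{0..<p}.
      G u v s (- a) y)"
    by (intro sum.cong refl sum_shift[where g = "\<lambda>u. \<Sum>v\<in>_. \<Sum>y\<in>_. G u v _ _ y"])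
      (unfold periodic_mod_def, intro per; assumption)
  also have "\<dots> = (\<Sum>s\<in>{0..<p}. \<Sum>t\<in>{0..<p}. \<Sum>u\<in>{0..<p}. \<Sum>v\<in>{0..<p}. \<Sum>y\<in>{0..<p}. G u v s t y)"
    by (intro sum.cong refl sum_uminus[where g = "\<lambda>t. \<Sum>u\<in>_. \<Sum>v\<in>_. \<Sum>y\<in>_. G u v _ t y"])
      (unfold periodic_mod_def, intro per; assumption)
  also have "\<dots> = (\<Sum>s\<in>{0..<p}. \<Sum>u\<in>{0..<p}. \<Sum>v\<in>{0..<p}. \<Sum>t\<in>{0..<p}. \<Sum>y\<in>{0..<p}. G u v s t y)"
    by (rule sum.cong[OF refl], subst sum.swap, rule sum.cong[OF refl], rule sum.swap)
  also have "\<dots> = gadget_sum G"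
    by (subst sum.swap, rule sum.cong[OF refl], rule sum.swap)
  finally show ?thesis .
qed


text \<open>Over a pair \<open>u, v\<close> with \<open>u v \<noteq> w^2\<close> the determinant is linear in \<open>y\<close>. If \<open>u v = w^2\<close>, it does not
  depend on \<open>y\<close> and is, up to a unit, the square of a linear form in \<open>s, t\<close>. In both cases
  there are \<open>p^2\<close> zeros; the exception is \<open>u = v = w = 0\<close>, where all \<open>p^3\<close> triples are zeros.\<close>

lemma count_det3:
  "gadget_sum (\<lambda>u v s t y. zero_ind p (det3 (u, v, y, w, s, t))) = p^4 + (p^3 - p^2) * zero_ind p w"
proof -
  note const = sum_const_residues
  have inner: "(\<Sum>s\<in>{0..<p}. \<Sum>t\<in>{0..<p}. \<Sum>y\<in>{0..<p}. zero_ind p (det3 (u, v, y, w, s, t)))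
      = p^2 + (p^3 - p^2) * (zero_ind p w * (zero_ind p u * zero_ind p v))" for u v
  proof -
    define f where "f s t = 2 * w * s * t - u * t\<^sup>2 - v * s\<^sup>2" for s t
    have det: "det3 (u, v, y, w, s, t) = (u * v - w\<^sup>2) * y + f s t" for s t y
      by (simp add: f_def power2_eq_square algebra_simps)
    show ?thesis
    proof (cases "p dvd u * v - w\<^sup>2")
      case False
      then have "\<not> (p dvd u \<and> p dvd w)" by (auto simp: power2_eq_square)
      then have "zero_ind p w * (zero_ind p u * zero_ind p v) = 0" by (auto simp: zero_ind_def)
      moreover have "(\<Sum>y\<in>{0..<p}. zero_ind p (det3 (u, v, y, w, s, t))) = 1" for s t
        unfolding det using False by (rule count_linear)
      ultimately show ?thesis by (simp only: const) (simp add: power2_eq_square)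
    next
      case True
      have y: "(\<Sum>y\<in>{0..<p}. zero_ind p (det3 (u, v, y, w, s, t))) = p * zero_ind p (f s t)" for s t
        unfolding det using True by (rule count_linear_degenerate)
      consider "\<not> p dvd u" | "\<not> p dvd v" | "p dvd u" "p dvd v" by blast
      then show ?thesis
      proof cases
        case 1
        have "zero_ind p (f s t) = zero_ind p (u * t + (- w * s))" for s t
        proof -
          have "(u * t + (- w * s))\<^sup>2 + u * f s t = - s\<^sup>2 * (u * v - w\<^sup>2)"
            by (simp add: f_def power2_eq_square algebra_simps)
          then have "p dvd (u * t + (- w * s))\<^sup>2 + u * f s t" using True by simp
          then have "p dvd (u * t + (- w * s))\<^sup>2 \<longleftrightarrow> p dvd u * f s t"
            by (metis dvd_add_right_iff dvd_add_left_iff)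
          then show ?thesis using 1 by (simp only: zero_ind_def p_dvd_mult_iff p_dvd_square_iff simp_thms)
        qed
        then have "(\<Sum>s\<in>{0..<p}. \<Sum>t\<in>{0..<p}. zero_ind p (f s t)) = p"
          by (simp only: count_linear[OF 1] const mult_1_right)
        then show ?thesis using 1 
          by (simp only: y zero_ind_not_dvd simp_thms mult_zero_left mult_zero_right add_0_right power2_eq_square
              flip: sum_distrib_left)
      next
        case 2
        have "zero_ind p (f s t) = zero_ind p (v * s + (- w * t))" for s t
        proof -
          have "(v * s + (- w * t))\<^sup>2 + v * f s t = - t\<^sup>2 * (u * v - w\<^sup>2)"
            by (simp add: f_def power2_eq_square algebra_simps)
          then have "p dvd (v * s + (- w * t))\<^sup>2 + v * f s t" using True by simp
          then have "p dvd (v * s + (- w * t))\<^sup>2 \<longleftrightarrow> p dvd v * f s t"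
            by (metis dvd_add_right_iff dvd_add_left_iff)
          then show ?thesis using 2 by (simp only: zero_ind_def p_dvd_mult_iff p_dvd_square_iff simp_thms)
        qed
        then have "(\<Sum>s\<in>{0..<p}. \<Sum>t\<in>{0..<p}. zero_ind p (f s t)) = (\<Sum>t\<in>{0..<p}. \<Sum>s\<in>{0..<p}. zero_ind p (v * s + (- w * t)))"
          by (subst sum.swap) (simp only:)
        also have "\<dots> = p" by (simp only: count_linear[OF 2] const mult_1_right)
        finally show ?thesis using 2 
          by (simp only: y zero_ind_not_dvd simp_thms mult_zero_left mult_zero_right add_0_right power2_eq_square
              flip: sum_distrib_left)
      next
        case 3
        then have "p dvd u * v" by simp
        with True have "p dvd w\<^sup>2" using dvd_diff_right_iff by blast
        then have w: "p dvd w" by (simp only: p_dvd_square_iff)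
        then have "p dvd f s t" for s t using 3 by (simp add: f_def)
        then show ?thesis using 3 w
          by (simp only: y zero_ind_dvd const) (simp add: power2_eq_square power3_eq_cube)
      qed
    qed
  qed
  have one: "(\<Sum>u\<in>{0..<p}. zero_ind p u) = 1"
    using count_linear[of 1 0] p not_prime_unit by auto
  \<comment> \<open>The exceptional pair \<open>u = v = 0\<close> is counted once.\<close>
  have two: "(\<Sum>u\<in>{0..<p}. \<Sum>v\<in>{0..<p}. zero_ind p u * zero_ind p v) = 1"
    by (simp only: one flip: sum_distrib_left) (simp add: one)
  have "gadget_sum (\<lambda>u v s t y. zero_ind p (det3 (u, v, y, w, s, t)))
      = p * (p * p^2) + (p^3 - p^2) * (zero_ind p w * (\<Sum>u\<in>{0..<p}. \<Sum>v\<in>{0..<p}. zero_ind p u * zero_ind p v))"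
    by (simp only: inner sum.distrib const sum_distrib_left)
  then show ?thesis
    by (simp only: two) (simp add: power_numeral_reduce)
qed

text \<open>Multiplication by \<open>K^2\<close> turns the pencil into \<open>det (K D + N)\<close>, and \<open>K D + N\<close> runs over
  all symmetric matrices whose entry 12 is \<open>N12\<close>.\<close>

lemma gadget_sum_pencil_unit:
  assumes "coherent K (a, b, c, d, e, f) M T" and K: "\<not> p dvd K"
  shows "gadget_sum (\<lambda>u v s t y. zero_ind p (pencil K (a, b, c, d, e, f) M T (u, v, y, 0, s, t)))
       = p^4 + (p^3 - p^2) * zero_ind p d"
proof -
  obtain a' b' c' d' e' f' where M: "M = (a', b', c', d', e', f')" by (cases M)
  have sq: "K\<^sup>2 * pencil K (a, b, c, d, e, f) M T (u, v, y, 0, s, t)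
      = det3 (K * u + a, K * v + b, K * y + c, d, K * s + e, K * t + f)" for u v s t y
  proof -
    have rel: "K * a' = b * c - f * f" "K * b' = a * c - e * e" "K * c' = a * b - d * d"
      "K * d' = e * f - d * c" "K * e' = d * f - e * b" "K * f' = d * e - a * f"
      and T: "K * T = a * a' + d * d' + e * e'"
      using assms(1) by (simp_all add: M)
    have "K\<^sup>2 * pencil K (a, b, c, d, e, f) M T (u, v, y, 0, s, t)
        = K ^ 3 * det3 (u, v, y, 0, s, t) + K\<^sup>2 * pair3 (a, b, c, d, e, f) (adj3 (u, v, y, 0, s, t))
          + K * (K * a' * u + K * b' * v + K * c' * y + 2 * (K * e' * s + K * f' * t))
          + K * (K * T)"
      by (simp add: M pencil_def power2_eq_square power3_eq_cube algebra_simps)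
    moreover have "K * (K * T) = a * (K * a') + d * (K * d') + e * (K * e')"
      unfolding T by Groebner_Basis.algebra
    ultimately show ?thesis unfolding rel
      by (simp add: power2_eq_square power3_eq_cube algebra_simps)
  qed
  have "zero_ind p (pencil K (a, b, c, d, e, f) M T (u, v, y, 0, s, t))
      = zero_ind p (det3 (K * u + a, K * v + b, K * y + c, d, K * s + e, K * t + f))" for u v s t y
    using K unfolding sq[symmetric] by (simp only: zero_ind_def p_dvd_mult_iff p_dvd_square_iff simp_thms)
  moreover have "periodic5_mod p (\<lambda>u v s t y. zero_ind p (det3 (u, v, y, d, s, t)))"
    using periodic5_mod_zero_ind_pencil[of p 1 "(0,0,0,0,0,0)" "(0,0,0,0,0,0)" 0 d] by (simp add: pencil_def)
  ultimately show ?thesis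
    by (simp only: gadget_sum_affine[OF _ K, of "\<lambda>u v s t y. zero_ind p (det3 (u, v, y, d, s, t))"] count_det3)
qed

text \<open>After the shift, \<open>u\<close> and \<open>s\<close> are free, which gives a factor \<open>p^2\<close>. One more factor comes from
  the remaining three variables: the equation is linear in \<open>y\<close> with a leading coefficient in which
  \<open>t\<close> does not occur.\<close>

lemma gadget_sum_pencil_rank_one:
  assumes coh: "coherent K (a, b, c, d, e, f) (a', b', c', d', e', f') T"
    and K: "p dvd K" and a: "\<not> p dvd a"
  shows "p ^ 3 dvd gadget_sum (\<lambda>u v s t y.
    zero_ind p (pencil K (a, b, c, d, e, f) (a', b', c', d', e', f') T (u, v, y, 0, s, t)))"
proof -
  obtain i where i: "[a * i = 1] (mod p)" using inverse_mod_p[OF a] .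
  \<comment> \<open>The vector \<open>n = (1, g, h)\<close> with \<open>N = a n n^t\<close> modulo \<open>p\<close>.\<close>
  define g h where "g = i * d" and "h = i * e"
  define G where "G u v s t y
    = zero_ind p (pencil K (a, b, c, d, e, f) (a', b', c', d', e', f') T (u, v, y, 0, s, t))" for u v s t y
  define H where "H v t y = zero_ind p (a * (v * y - t\<^sup>2) + b' * v + 2 * f' * t + c' * y + T)" for v t y
  have G: "periodic5_mod p G" unfolding G_def by (rule periodic5_mod_zero_ind_pencil)
  note per = allI impI refl sum.cong periodic5_modD[OF G] cong_refl
  have shift: "G u (v + - (g\<^sup>2 * u)) s (t + (g * s - g * h * u)) (y + (2 * h * s - h\<^sup>2 * u)) = H v t y" for u v s t y
    unfolding G_def H_def using pencil_rank_one_shift[OF coh K i, of u v y s t]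
    by (intro zero_ind_cong) (simp add: g_def h_def algebra_simps)
  have "gadget_sum G = (\<Sum>u\<in>{0..<p}. \<Sum>s\<in>{0..<p}. \<Sum>v\<in>{0..<p}. \<Sum>t\<in>{0..<p}. \<Sum>y\<in>{0..<p}. G u v s t y)"
    by (rule sum.cong[OF refl], rule sum.swap)
  also have "\<dots> = (\<Sum>u\<in>{0..<p}. \<Sum>s\<in>{0..<p}. \<Sum>v\<in>{0..<p}. \<Sum>t\<in>{0..<p}. \<Sum>y\<in>{0..<p}.
      G u (v + - (g\<^sup>2 * u)) s t y)"
    by (intro sum.cong refl sum_shift[where g = "\<lambda>v. \<Sum>t\<in>_. \<Sum>y\<in>_. G _ v _ t y", symmetric])
      (unfold periodic_mod_def, intro per; assumption)
  also have "\<dots> = (\<Sum>u\<in>{0..<p}. \<Sum>s\<in>{0..<p}. \<Sum>v\<in>{0..<p}. \<Sum>t\<in>{0..<p}. \<Sum>y\<in>{0..<p}.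
      G u (v + - (g\<^sup>2 * u)) s (t + (g * s - g * h * u)) y)"
    by (intro sum.cong refl sum_shift[where g = "\<lambda>t. \<Sum>y\<in>_. G _ _ _ t y", symmetric])
      (unfold periodic_mod_def, intro per; assumption)
  also have "\<dots> = (\<Sum>u\<in>{0..<p}. \<Sum>s\<in>{0..<p}. \<Sum>v\<in>{0..<p}. \<Sum>t\<in>{0..<p}. \<Sum>y\<in>{0..<p}.
      G u (v + - (g\<^sup>2 * u)) s (t + (g * s - g * h * u)) (y + (2 * h * s - h\<^sup>2 * u)))"
    by (intro sum.cong refl sum_shift[where g = "\<lambda>y. G _ _ _ _ y", symmetric])
      (unfold periodic_mod_def, intro per; assumption)
  also have "\<dots> = p * (p * (\<Sum>v\<in>{0..<p}. \<Sum>t\<in>{0..<p}. \<Sum>y\<in>{0..<p}. H v t y))"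
    by (simp only: shift sum_const_residues)
  finally have sum: "gadget_sum G = p * (p * (\<Sum>v\<in>{0..<p}. \<Sum>t\<in>{0..<p}. \<Sum>y\<in>{0..<p}. H v t y))" .
  have "[(\<Sum>v\<in>{0..<p}. \<Sum>t\<in>{0..<p}. \<Sum>y\<in>{0..<p}. H v t y)
      = (\<Sum>v\<in>{0..<p}. \<Sum>t\<in>{0..<p}. 1 - zero_ind p (a * v + c'))] (mod p)"
  proof (intro cong_sum)
    fix v t
    have "H v t y = zero_ind p ((a * v + c') * y + (- a * t\<^sup>2 + b' * v + 2 * f' * t + T))" for y
      unfolding H_def by (rule arg_cong[where f = "zero_ind p"]) Groebner_Basis.algebra
    then show "[(\<Sum>y\<in>{0..<p}. H v t y) = 1 - zero_ind p (a * v + c')] (mod p)"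
      by (simp only: count_linear_cong)
  qed
  also have "[(\<Sum>v\<in>{0..<p}. \<Sum>t\<in>{0..<p}. 1 - zero_ind p (a * v + c')) = 0] (mod p)"
    unfolding sum_const_residues cong_0_iff by (intro dvd_sum dvd_triv_left)
  finally have "p dvd (\<Sum>v\<in>{0..<p}. \<Sum>t\<in>{0..<p}. \<Sum>y\<in>{0..<p}. H v t y)" by (simp only: cong_0_iff)
  then show ?thesis unfolding G_def[symmetric] sum
    by (simp only: power3_eq_cube mult.assoc mult_dvd_mono dvd_refl)
qed

text \<open>Exchanging the first two coordinates exchanges the roles of \<open>N11\<close> and \<open>N22\<close>.\<close>

lemma pencil_swap:
  "pencil K (a, b, c, d, e, f) (a', b', c', d', e', f') T (u, v, y, 0, s, t)
 = pencil K (b, a, c, d, f, e) (b', a', c', d', f', e') T (v, u, y, 0, t, s)"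
  by (simp add: pencil_def algebra_simps)

lemma coherent_swap:
  "coherent K (a, b, c, d, e, f) (a', b', c', d', e', f') T \<Longrightarrow>
   coherent K (b, a, c, d, f, e) (b', a', c', d', f', e') T"
  by (simp add: algebra_simps)

lemma gadget_sum_affine_form:
  "p ^ 3 dvd gadget_sum (\<lambda>u v s t y. zero_ind p (ku * u + kv * v + ks * s + kt * t + ky * y + k))"
proof -
  note const = sum_const_residues
  consider "\<not> p dvd ky" | "p dvd ky" "\<not> p dvd kt" | "p dvd ky" "p dvd kt" "\<not> p dvd ks"
    | "p dvd ky" "p dvd kt" "p dvd ks" by blast
  then show ?thesis
  proof cases
    case 1
    have "(\<Sum>y\<in>{0..<p}. zero_ind p (ku * u + kv * v + ks * s + kt * t + ky * y + k)) = 1" for u v s t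
      using count_linear[OF 1, of "ku * u + kv * v + ks * s + kt * t + k"] by (simp only: ac_simps)
    then show ?thesis by (simp add: const power3_eq_cube)
  next
    case 2
    have "(\<Sum>y\<in>{0..<p}. zero_ind p (ku * u + kv * v + ks * s + kt * t + ky * y + k))
        = p * zero_ind p (kt * t + (ku * u + kv * v + ks * s + k))" for u v s t
      using count_linear_degenerate[OF 2(1), of "ku * u + kv * v + ks * s + kt * t + k"]
      by (simp only: ac_simps)
    then have "(\<Sum>t\<in>{0..<p}. \<Sum>y\<in>{0..<p}. zero_ind p (ku * u + kv * v + ks * s + kt * t + ky * y + k)) = p" for u v s
      by (simp only: count_linear[OF 2(2)] mult_1_right flip: sum_distrib_left)
    then show ?thesis by (simp add: const power3_eq_cube)
  next
    case 3
    have "zero_ind p (ku * u + kv * v + ks * s + kt * t + ky * y + k) = zero_ind p (ks * s + (ku * u + kv * v + k))" for u v s t y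
      using 3 by (intro zero_ind_cong_0) simp
    then have "(\<Sum>s\<in>{0..<p}. \<Sum>t\<in>{0..<p}. \<Sum>y\<in>{0..<p}. zero_ind p (ku * u + kv * v + ks * s + kt * t + ky * y + k)) = p * p" for u v
      by (simp only: const count_linear[OF 3(3)] mult_1_right flip: sum_distrib_left)
    then show ?thesis by (simp add: const power3_eq_cube)
  next
    case 4
    have "zero_ind p (ku * u + kv * v + ks * s + kt * t + ky * y + k) = zero_ind p (ku * u + kv * v + k)" for u v s t y
      using 4 by (intro zero_ind_cong_0) simp
    then show ?thesis
      by (simp only: const power3_eq_cube mult.assoc) (intro dvd_sum, simp add: mult_dvd_mono)
  qed
qed

text \<open>If \<open>K\<close>, \<open>N11\<close> and \<open>N22\<close> vanish, then \<open>N33\<close> is the only entry of \<open>N\<close> that may survive. Either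
  it vanishes as well and the pencil is affine linear, or it annihilates the last column of \<open>M\<close>
  and the pencil does not involve \<open>s, t, y\<close>.\<close>

lemma gadget_sum_pencil_degenerate:
  assumes coh: "coherent K (a, b, c, d, e, f) (a', b', c', d', e', f') T"
    and K: "p dvd K" and a: "p dvd a" and b: "p dvd b"
  shows "p ^ 3 dvd gadget_sum (\<lambda>u v s t y.
    zero_ind p (pencil K (a, b, c, d, e, f) (a', b', c', d', e', f') T (u, v, y, 0, s, t)))"
proof -
  note const = sum_const_residues
  have rel: "K * a' = b * c - f * f" "K * b' = a * c - e * e" "K * c' = a * b - d * d"
    "e * a' + f * d' + c * e' = 0" "e * d' + f * b' + c * f' = 0" "e * e' + f * f' + c * c' = K * T"
    using coh by simp_all
  have "d * d = a * b - K * c'" "e * e = a * c - K * b'" "f * f = b * c - K * a'" using rel by simp_all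
  then have "p dvd d * d" "p dvd e * e" "p dvd f * f" using K a b by simp_all
  then have d: "p dvd d" and e: "p dvd e" and f: "p dvd f" by (simp_all only: p_dvd_mult_iff simp_thms)
  have red: "zero_ind p (pencil K (a, b, c, d, e, f) (a', b', c', d', e', f') T (u, v, y, 0, s, t))
      = zero_ind p (c * (u * v) + (a' * u + b' * v + 2 * e' * s + 2 * f' * t + c' * y + T))" for u v s t y
  proof (rule zero_ind_cong_0)
    have "pencil K (a, b, c, d, e, f) (a', b', c', d', e', f') T (u, v, y, 0, s, t)
        - (c * (u * v) + (a' * u + b' * v + 2 * e' * s + 2 * f' * t + c' * y + T))
        = K * det3 (u, v, y, 0, s, t) + a * (v * y - t * t) + b * (u * y - s * s)
          + d * (2 * s * t) + e * (- 2 * s * v) + f * (- 2 * u * t)"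
      by (simp add: pencil_def algebra_simps)
    also have "p dvd \<dots>" by (intro dvd_add dvd_mult2 a b d e f K)
    finally show "p dvd pencil K (a, b, c, d, e, f) (a', b', c', d', e', f') T (u, v, y, 0, s, t)
        - (c * (u * v) + (a' * u + b' * v + 2 * e' * s + 2 * f' * t + c' * y + T))" .
  qed
  show ?thesis
  proof (cases "p dvd c")
    case True
    then have "zero_ind p (c * (u * v) + (a' * u + b' * v + 2 * e' * s + 2 * f' * t + c' * y + T))
        = zero_ind p (a' * u + b' * v + (2 * e') * s + (2 * f') * t + c' * y + T)" for u v s t y
      by (intro zero_ind_cong_0) simp
    then show ?thesis unfolding red by (simp only: gadget_sum_affine_form)
  next
    case False
    have "c * e' = - (e * a' + f * d')" "c * f' = - (e * d' + f * b')" "c * c' = K * T - e * e' - f * f'"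
      using rel by simp_all
    then have "p dvd c * e'" "p dvd c * f'" "p dvd c * c'" using K e f by simp_all
    then have "p dvd e'" "p dvd f'" "p dvd c'" using False by (simp_all only: p_dvd_mult_iff simp_thms)
    then have "zero_ind p (c * (u * v) + (a' * u + b' * v + 2 * e' * s + 2 * f' * t + c' * y + T))
        = zero_ind p (c * (u * v) + (a' * u + b' * v + T))" for u v s t y
      by (intro zero_ind_cong_0) simp
    then show ?thesis unfolding red
      by (simp only: const power3_eq_cube mult.assoc) (intro dvd_sum, simp add: mult_dvd_mono)
  qed
qed

text \<open>The number of zeros in the variables of one gadget, attached to an arbitrary network.\<close>

lemma gadget_sum_pencil:
  assumes coh: "coherent K (a, b, c, d, e, f) M T"
  shows "[gadget_sum (\<lambda>u v s t y. zero_ind p (pencil K (a, b, c, d, e, f) M T (u, v, y, 0, s, t)))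
        = - (p\<^sup>2 * ((1 - zero_ind p K) * zero_ind p d))] (mod p ^ 3)"
proof -
  obtain a' b' c' d' e' f' where M: "M = (a', b', c', d', e', f')" by (cases M)
  note coh' = coh[unfolded M]
  consider "\<not> p dvd K" | "p dvd K" "\<not> p dvd a" | "p dvd K" "\<not> p dvd b" | "p dvd K" "p dvd a" "p dvd b"
    by blast
  then show ?thesis
  proof cases
    case 1
    have "p^4 + (p^3 - p^2) * zero_ind p d - - (p\<^sup>2 * ((1 - zero_ind p K) * zero_ind p d)) = p^3 * (p + zero_ind p d)"
      using 1 by (simp add: zero_ind_not_dvd power_numeral_reduce algebra_simps)
    then show ?thesis unfolding gadget_sum_pencil_unit[OF coh 1] cong_iff_dvd_diff by simp
  next
    case 2
    then show ?thesis using gadget_sum_pencil_rank_one[OF coh' 2] by (simp add: M zero_ind_dvd cong_0_iff)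
  next
    case 3
    have "gadget_sum (\<lambda>u v s t y. zero_ind p (pencil K (a, b, c, d, e, f) M T (u, v, y, 0, s, t)))
        = gadget_sum (\<lambda>v u t s y. zero_ind p (pencil K (b, a, c, d, f, e) (b', a', c', d', f', e') T (v, u, y, 0, t, s)))"
      unfolding M pencil_swap[of K a]
      by (subst sum.swap, rule sum.cong[OF refl], rule sum.cong[OF refl], rule sum.swap)
    then show ?thesis using gadget_sum_pencil_rank_one[OF coherent_swap[OF coh'] 3] 3(1)
      by (simp only: zero_ind_dvd cong_0_iff diff_self mult_zero_left mult_zero_right minus_zero)
  next
    case 4
    then show ?thesis using gadget_sum_pencil_degenerate[OF coh' 4] by (simp add: M zero_ind_dvd cong_0_iff)
  qed
qed

end

section \<open>The four-cycle with one gadget\<close>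

fun entry12 :: "sym3 \<Rightarrow> int" where "entry12 (a, b, c, d, e, f) = d"

text \<open>The coefficients of the network that results when a gadget with matrix \<open>R\<close> is attached to a
  network with coefficients \<open>K, N, M, T\<close>. The new resistance matrix is the parallel sum
  \<open>(S^-1 + R^-1)^-1\<close> and the new \<open>K\<close> is \<open>K det (R + S)\<close>; clearing denominators gives these formulas.
  The third summand of \<open>attach_N\<close> is the polarisation of \<open>adj\<close> at \<open>M\<close> and \<open>adj R\<close>.\<close>

definition attach_N :: "sym3 \<Rightarrow> sym3 \<Rightarrow> int \<Rightarrow> sym3 \<Rightarrow> sym3" where
  "attach_N N M T R = add3 (add3 (scale3 (det3 R) N) (scale3 T R))
     (add3 (adj3 (add3 M (adj3 R))) (scale3 (- 1) (add3 (adj3 M) (adj3 (adj3 R)))))"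

definition attach_M :: "sym3 \<Rightarrow> int \<Rightarrow> sym3 \<Rightarrow> sym3" where
  "attach_M M T R = add3 (scale3 (det3 R) M) (scale3 T (adj3 R))"

text \<open>The four-cycle with edges \<open>z1, z2, z3, z4\<close>. With corners numbered \<open>1, 2, 3, 4\<close> along it, the three
  loops enter and leave at the corners \<open>1, 3\<close>, at \<open>2, 4\<close>, and at \<open>1, 2\<close>. A diagonal entry of \<open>N\<close> sums
  over the spanning forests with two trees that separate the two corners. The matrix \<open>M\<close>
  is the conductance matrix multiplied by the product of all \<open>z\<close>.\<close>

definition cycle_K :: "int \<Rightarrow> int \<Rightarrow> int \<Rightarrow> int \<Rightarrow> int" where
  "cycle_K z1 z2 z3 z4 = z1 + z2 + z3 + z4"

definition cycle_N :: "int \<Rightarrow> int \<Rightarrow> int \<Rightarrow> int \<Rightarrow> sym3" where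
  "cycle_N z1 z2 z3 z4 = ((z1 + z2) * (z3 + z4), (z2 + z3) * (z1 + z4), z1 * (z2 + z3 + z4),
     z2 * z4 - z1 * z3, z1 * (z3 + z4), - (z1 * (z2 + z3)))"

definition cycle_M :: "int \<Rightarrow> int \<Rightarrow> int \<Rightarrow> int \<Rightarrow> sym3" where
  "cycle_M z1 z2 z3 z4 = (z1 * z4 * (z2 + z3), z1 * z2 * (z3 + z4),
     z2 * z3 * z4 + z1 * z3 * z4 + z1 * z2 * z4 + z1 * z2 * z3,
     - (z1 * z2 * z4), - (z1 * z4 * (z2 + z3)), z1 * z2 * (z3 + z4))"

definition cycle_T :: "int \<Rightarrow> int \<Rightarrow> int \<Rightarrow> int \<Rightarrow> int" where
  "cycle_T z1 z2 z3 z4 = z1 * z2 * z3 * z4"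

lemmas cycle_defs = cycle_K_def cycle_N_def cycle_M_def cycle_T_def
lemmas sym3_simps = adj3.simps det3.simps pair3.simps add3.simps scale3.simps entry12.simps

text \<open>Polynomial identities in the nine edge variables of the four-cycle and the gadget. In terms of
  \<open>S\<close> and \<open>R\<close> they express that the adjugate of the parallel sum is a multiple of \<open>S^-1 + R^-1\<close>.\<close>

lemma coherent_attach_cycle:
  fixes z1 z2 z3 z4 f g h k l
  defines "R \<equiv> (f, g, h, 0, k, l)"
    and "E \<equiv> cycle_K z1 z2 z3 z4" and "N \<equiv> cycle_N z1 z2 z3 z4"
    and "M \<equiv> cycle_M z1 z2 z3 z4" and "T \<equiv> cycle_T z1 z2 z3 z4"
  shows "coherent (pencil E N M T R) (attach_N N M T R) (attach_M M T R) (T * det3 R)"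
  unfolding assms cycle_defs pencil_def attach_N_def attach_M_def sym3_simps coherent.simps prod.inject
  by (intro conjI; Groebner_Basis.algebra)

text \<open>Both \<open>K\<close> and \<open>N12\<close> of the four-cycle with a gadget are linear in the entry \<open>h\<close>, and the derivative
  of \<open>N12 / K\<close> in \<open>h\<close> is a product of two entries of a column of \<open>S (R + S)^-1\<close> because \<open>h\<close> perturbs \<open>R\<close>
  by a matrix of rank one. Hence the resultant splits. The factors are linear in \<open>k\<close> and
  \<open>l\<close>, and by the last equation their determinant is again a product.\<close>

lemma resultant_factors:
  fixes z1 z2 z3 z4 f g k l
  defines "K0 \<equiv> pencil (cycle_K z1 z2 z3 z4) (cycle_N z1 z2 z3 z4) (cycle_M z1 z2 z3 z4) (cycle_T z1 z2 z3 z4)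
      (f, g, 0, 0, k, l)"
    and "W0 \<equiv> entry12 (attach_N (cycle_N z1 z2 z3 z4) (cycle_M z1 z2 z3 z4)
      (cycle_T z1 z2 z3 z4) (f, g, 0, 0, k, l))"
  defines "n11 \<equiv> (z1 + z2) * (z3 + z4)" and "n22 \<equiv> (z2 + z3) * (z1 + z4)" and "n12 \<equiv> z2 * z4 - z1 * z3"
    and "m33 \<equiv> z2 * z3 * z4 + z1 * z3 * z4 + z1 * z2 * z4 + z1 * z2 * z3"
  defines "K1 \<equiv> ((z1 + z2 + z3 + z4) * f + n11) * g + (n22 * f + m33)"
  shows "pencil (cycle_K z1 z2 z3 z4) (cycle_N z1 z2 z3 z4) (cycle_M z1 z2 z3 z4) (cycle_T z1 z2 z3 z4)
      (f, g, h, 0, k, l) = K1 * h + K0" (is ?K)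
    and "entry12 (attach_N (cycle_N z1 z2 z3 z4) (cycle_M z1 z2 z3 z4)
      (cycle_T z1 z2 z3 z4) (f, g, h, 0, k, l)) = f * g * n12 * h + W0" (is ?W)
    and "K1 * W0 - K0 * (f * g * n12)
      = - ((f * n12 * l + ((g * n11 + m33) * k - f * (g * z1 * (z3 + z4) + z1 * z4 * (z2 + z3))))
         * ((f * n22 + m33) * l + (g * n12 * k + g * (f * z1 * (z2 + z3) + z1 * z2 * (z3 + z4)))))" (is ?R)
    and "(f * n12) * (g * n12) - (g * n11 + m33) * (f * n22 + m33) = - (m33 * K1)" (is ?D)
proof -
  note defs = assms cycle_defs pencil_def attach_N_def sym3_simps
  show ?K unfolding defs by Groebner_Basis.algebra
  show ?W unfolding defs by Groebner_Basis.algebra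
  show ?R unfolding defs by Groebner_Basis.algebra
  show ?D unfolding defs by Groebner_Basis.algebra
qed

context prime_modulus
begin

text \<open>The variables are eliminated in the order \<open>h, l, k, g, f\<close>. A term that does not depend on the
  current variable sums to a multiple of \<open>p\<close>, so of each elimination only the resultants and leading
  coefficients that still involve the next variable survive.\<close>

lemma count_gadget:
  fixes z1 z2 z3 z4
  defines "m33 \<equiv> z2 * z3 * z4 + z1 * z3 * z4 + z1 * z2 * z4 + z1 * z2 * z3"
  defines "E \<equiv> cycle_K z1 z2 z3 z4" and "N \<equiv> cycle_N z1 z2 z3 z4"
    and "M \<equiv> cycle_M z1 z2 z3 z4" and "T \<equiv> cycle_T z1 z2 z3 z4"
  shows "[gadget_sum (\<lambda>f g k l h. (1 - zero_ind p (pencil E N M T (f, g, h, 0, k, l)))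
              * zero_ind p (entry12 (attach_N N M T (f, g, h, 0, k, l))))
        = (1 - zero_ind p m33) * (1 - zero_ind p E)] (mod p)"
proof -
  define n11 n22 n12 where "n11 = (z1 + z2) * (z3 + z4)" and "n22 = (z2 + z3) * (z1 + z4)"
    and "n12 = z2 * z4 - z1 * z3"
  define K1 where "K1 f g = (E * f + n11) * g + (n22 * f + m33)" for f g
  define W1 where "W1 f g = f * g * n12" for f g
  define K0 where "K0 f g k l = pencil E N M T (f, g, 0, 0, k, l)" for f g k l
  define W0 where "W0 f g k l = entry12 (attach_N N M T (f, g, 0, 0, k, l))" for f g k l
  \<comment> \<open>The resultant in \<open>h\<close> is \<open>- U V\<close>; \<open>c\<close> and \<open>c'\<close> collect the terms of its factors without \<open>k, l\<close>.\<close>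
  define c where "c f g = - (f * (g * z1 * (z3 + z4) + z1 * z4 * (z2 + z3)))" for f g
  define c' where "c' f g = g * (f * z1 * (z2 + z3) + z1 * z2 * (z3 + z4))" for f g
  define U where "U f g k l = f * n12 * l + ((g * n11 + m33) * k + c f g)" for f g k l
  define V where "V f g k l = (f * n22 + m33) * l + (g * n12 * k + c' f g)" for f g k l
  note factors = resultant_factors[of z1 z2 z3 z4, folded cycle_K_def[of z1 z2 z3 z4] E_def N_def M_def T_def
      m33_def n11_def n22_def n12_def]
  have K: "pencil E N M T (f, g, h, 0, k, l) = K1 f g * h + K0 f g k l"
    and W: "entry12 (attach_N N M T (f, g, h, 0, k, l)) = W1 f g * h + W0 f g k l" for f g h k l
    unfolding K1_def K0_def W1_def W0_def by (rule factors)+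
  have R: "K1 f g * W0 f g k l - K0 f g k l * W1 f g = - (U f g k l * V f g k l)" for f g k l
    unfolding K1_def K0_def W1_def W0_def U_def V_def c_def c'_def using factors(3)[of f g k l] by simp
  have D: "(f * n12) * (g * n12) - (g * n11 + m33) * (f * n22 + m33) = - (m33 * K1 f g)" for f g
    unfolding K1_def E_def cycle_K_def m33_def n11_def n12_def n22_def by Groebner_Basis.algebra
  have sum_h: "[(\<Sum>h\<in>{0..<p}. (1 - zero_ind p (pencil E N M T (f, g, h, 0, k, l)))
            * zero_ind p (entry12 (attach_N N M T (f, g, h, 0, k, l))))
      = (1 - zero_ind p (W1 f g) + zero_ind p (K1 f g) * zero_ind p (W1 f g))
        - zero_ind p (U f g k l) - zero_ind p (V f g k l) + zero_ind p (U f g k l) * zero_ind p (V f g k l)] (mod p)" for f g k l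
  proof -
    have "(\<Sum>h\<in>{0..<p}. (1 - zero_ind p (pencil E N M T (f, g, h, 0, k, l)))
            * zero_ind p (entry12 (attach_N N M T (f, g, h, 0, k, l))))
        = (\<Sum>h\<in>{0..<p}. zero_ind p (W1 f g * h + W0 f g k l))
          - (\<Sum>h\<in>{0..<p}. zero_ind p (K1 f g * h + K0 f g k l) * zero_ind p (W1 f g * h + W0 f g k l))"
      unfolding K W by (simp add: left_diff_distrib sum_subtractf)
    also have "[\<dots> = (1 - zero_ind p (W1 f g)) - (zero_ind p (- (U f g k l * V f g k l)) - zero_ind p (K1 f g) * zero_ind p (W1 f g))] (mod p)"
      unfolding R[symmetric] by (intro cong_diff count_linear_cong count_two_linear_cong)
    also have "zero_ind p (- (U f g k l * V f g k l)) = zero_ind p (U f g k l) + zero_ind p (V f g k l) - zero_ind p (U f g k l) * zero_ind p (V f g k l)"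
      unfolding zero_ind_mult[symmetric] by (simp add: zero_ind_def)
    finally show ?thesis by (simp add: algebra_simps)
  qed
  have sum_l: "[(\<Sum>l\<in>{0..<p}. \<Sum>h\<in>{0..<p}. (1 - zero_ind p (pencil E N M T (f, g, h, 0, k, l)))
            * zero_ind p (entry12 (attach_N N M T (f, g, h, 0, k, l))))
      = (0 - (1 - zero_ind p (f * n12)) - (1 - zero_ind p (f * n22 + m33)))
        + (zero_ind p (- (m33 * K1 f g) * k + (f * n12 * c' f g - c f g * (f * n22 + m33)))
          - zero_ind p (f * n12) * zero_ind p (f * n22 + m33))] (mod p)" for f g k
  proof -
    have "[(\<Sum>l\<in>{0..<p}. \<Sum>h\<in>{0..<p}. (1 - zero_ind p (pencil E N M T (f, g, h, 0, k, l)))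
            * zero_ind p (entry12 (attach_N N M T (f, g, h, 0, k, l))))
      = (\<Sum>l\<in>{0..<p}. (1 - zero_ind p (W1 f g) + zero_ind p (K1 f g) * zero_ind p (W1 f g))
        - zero_ind p (U f g k l) - zero_ind p (V f g k l) + zero_ind p (U f g k l) * zero_ind p (V f g k l))] (mod p)"
      by (intro cong_sum sum_h)
    also have "(\<Sum>l\<in>{0..<p}. (1 - zero_ind p (W1 f g) + zero_ind p (K1 f g) * zero_ind p (W1 f g))
        - zero_ind p (U f g k l) - zero_ind p (V f g k l) + zero_ind p (U f g k l) * zero_ind p (V f g k l))
      = (\<Sum>l\<in>{0..<p}. 1 - zero_ind p (W1 f g) + zero_ind p (K1 f g) * zero_ind p (W1 f g))
        - (\<Sum>l\<in>{0..<p}. zero_ind p (U f g k l)) - (\<Sum>l\<in>{0..<p}. zero_ind p (V f g k l))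
        + (\<Sum>l\<in>{0..<p}. zero_ind p (U f g k l) * zero_ind p (V f g k l))"
      by (simp only: sum.distrib sum_subtractf)
    also have "[\<dots> = (0 - (1 - zero_ind p (f * n12)) - (1 - zero_ind p (f * n22 + m33)))
        + (zero_ind p (f * n12 * (g * n12 * k + c' f g) - ((g * n11 + m33) * k + c f g) * (f * n22 + m33))
          - zero_ind p (f * n12) * zero_ind p (f * n22 + m33))] (mod p)"
      unfolding U_def V_def
      by (intro cong_add cong_diff cong_sum_0 count_linear_cong count_two_linear_cong)
    also have "f * n12 * (g * n12 * k + c' f g) - ((g * n11 + m33) * k + c f g) * (f * n22 + m33)
        = - (m33 * K1 f g) * k + (f * n12 * c' f g - c f g * (f * n22 + m33))"
      unfolding D[symmetric] by (simp add: algebra_simps)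
    finally show ?thesis .
  qed
  have sum_k: "[(\<Sum>k\<in>{0..<p}. \<Sum>l\<in>{0..<p}. \<Sum>h\<in>{0..<p}. (1 - zero_ind p (pencil E N M T (f, g, h, 0, k, l)))
            * zero_ind p (entry12 (attach_N N M T (f, g, h, 0, k, l))))
      = (1 - zero_ind p m33) * (1 - zero_ind p (K1 f g))] (mod p)" for f g
  proof -
    let ?C = "0 - (1 - zero_ind p (f * n12)) - (1 - zero_ind p (f * n22 + m33))" and ?C' = "zero_ind p (f * n12) * zero_ind p (f * n22 + m33)"
    have "[(\<Sum>k\<in>{0..<p}. \<Sum>l\<in>{0..<p}. \<Sum>h\<in>{0..<p}. (1 - zero_ind p (pencil E N M T (f, g, h, 0, k, l)))
            * zero_ind p (entry12 (attach_N N M T (f, g, h, 0, k, l))))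
        = (\<Sum>k\<in>{0..<p}. ?C + (zero_ind p (- (m33 * K1 f g) * k + (f * n12 * c' f g - c f g * (f * n22 + m33))) - ?C'))]
        (mod p)"
      by (intro cong_sum sum_l)
    also have "(\<Sum>k\<in>{0..<p}. ?C + (zero_ind p (- (m33 * K1 f g) * k + (f * n12 * c' f g - c f g * (f * n22 + m33))) - ?C'))
        = (\<Sum>k\<in>{0..<p}. ?C) + ((\<Sum>k\<in>{0..<p}. zero_ind p (- (m33 * K1 f g) * k
            + (f * n12 * c' f g - c f g * (f * n22 + m33)))) - (\<Sum>k\<in>{0..<p}. ?C'))"
      by (simp only: sum.distrib sum_subtractf)
    also have "[\<dots> = 0 + ((1 - zero_ind p (- (m33 * K1 f g))) - 0)] (mod p)"
      by (intro cong_add cong_diff cong_sum_0 count_linear_cong)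
    also have "0 + ((1 - zero_ind p (- (m33 * K1 f g))) - 0) = (1 - zero_ind p m33) * (1 - zero_ind p (K1 f g))"
      using zero_ind_mult[of m33 "K1 f g"] by (simp add: zero_ind_def algebra_simps)
    finally show ?thesis .
  qed
  have "[gadget_sum (\<lambda>f g k l h. (1 - zero_ind p (pencil E N M T (f, g, h, 0, k, l)))
              * zero_ind p (entry12 (attach_N N M T (f, g, h, 0, k, l))))
      = (\<Sum>f\<in>{0..<p}. \<Sum>g\<in>{0..<p}. (1 - zero_ind p m33) * (1 - zero_ind p (K1 f g)))] (mod p)"
    by (intro cong_sum sum_k)
  also have "(\<Sum>f\<in>{0..<p}. \<Sum>g\<in>{0..<p}. (1 - zero_ind p m33) * (1 - zero_ind p (K1 f g)))
      = (1 - zero_ind p m33) * (\<Sum>f\<in>{0..<p}. (\<Sum>g\<in>{0..<p}. 1) - (\<Sum>g\<in>{0..<p}. zero_ind p (K1 f g)))"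
    by (simp only: sum_subtractf sum_distrib_left right_diff_distrib)
  also have "[\<dots> = (1 - zero_ind p m33) * (\<Sum>f\<in>{0..<p}. 0 - (1 - zero_ind p (E * f + n11)))] (mod p)"
    unfolding K1_def by (intro cong_mult cong_refl cong_sum cong_diff cong_sum_0 count_linear_cong)
  also have "(\<Sum>f\<in>{0..<p}. 0 - (1 - zero_ind p (E * f + n11))) = (\<Sum>f\<in>{0..<p}. zero_ind p (E * f + n11)) - (\<Sum>f\<in>{0..<p}. 1)"
    by (simp add: sum_subtractf)
  also have "[(1 - zero_ind p m33) * ((\<Sum>f\<in>{0..<p}. zero_ind p (E * f + n11)) - (\<Sum>f\<in>{0..<p}. 1))
      = (1 - zero_ind p m33) * ((1 - zero_ind p E) - 0)] (mod p)"
    by (intro cong_mult cong_refl cong_diff cong_sum_0 count_linear_cong)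
  finally show ?thesis by simp
qed

text \<open>Three planes whose equations are linearly independent unless \<open>p = 2\<close>. The factor 2 enters as the
  resultant of \<open>z2 + z1\<close> and \<open>z2 - z1\<close>, which is \<open>- 2 z1\<close>.\<close>

lemma count_cayley:
  "[(\<Sum>z1\<in>{0..<p}. \<Sum>z2\<in>{0..<p}. \<Sum>z3\<in>{0..<p}. zero_ind p ((z2 + z1) * ((z3 + z1) * (z3 + z2)))) = 1 - zero_ind p 2] (mod p)"
proof -
  have "[(\<Sum>z3\<in>{0..<p}. zero_ind p ((z2 + z1) * ((z3 + z1) * (z3 + z2)))) 
      = 2 - zero_ind p (z2 - z1) - zero_ind p (z2 + z1) * 2 + zero_ind p (z2 + z1) * zero_ind p (z2 - z1)] (mod p)" for z1 z2
  proof -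
    have "(\<Sum>z3\<in>{0..<p}. zero_ind p ((z2 + z1) * ((z3 + z1) * (z3 + z2)))) 
      = (\<Sum>z3\<in>{0..<p}. zero_ind p (z2 + z1)) + (1 - zero_ind p (z2 + z1)) * ((\<Sum>z3\<in>{0..<p}. zero_ind p (z3 + z1))
         + (\<Sum>z3\<in>{0..<p}. zero_ind p (z3 + z2)) - (\<Sum>z3\<in>{0..<p}. zero_ind p (1 * z3 + z1) * zero_ind p (z3 + z2)))"
      unfolding zero_ind_mult by (simp add: sum.distrib sum_subtractf sum_distrib_left algebra_simps)
    also have "[\<dots> = 0 + (1 - zero_ind p (z2 + z1)) * (1 + 1 - zero_ind p (1 * z2 - z1))] (mod p)"
      by (intro cong_add cong_diff cong_mult cong_refl cong_sum_0 count_one_linear_cong count_two_monic_cong)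
    finally show ?thesis by (simp add: algebra_simps)
  qed
  then have "[(\<Sum>z1\<in>{0..<p}. \<Sum>z2\<in>{0..<p}. \<Sum>z3\<in>{0..<p}. zero_ind p ((z2 + z1) * ((z3 + z1) * (z3 + z2))))
      = (\<Sum>z1\<in>{0..<p}. \<Sum>z2\<in>{0..<p}. 
          2 - zero_ind p (z2 - z1) - zero_ind p (z2 + z1) * 2 + zero_ind p (z2 + z1) * zero_ind p (z2 - z1))] (mod p)"
    by (intro cong_sum)
  also have "[(\<Sum>z1\<in>{0..<p}. \<Sum>z2\<in>{0..<p}. 
          2 - zero_ind p (z2 - z1) - zero_ind p (z2 + z1) * 2 + zero_ind p (z2 + z1) * zero_ind p (z2 - z1))
      = (\<Sum>z1\<in>{0..<p}. - 3 + zero_ind p (2 * z1 + 0))] (mod p)"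
  proof (intro cong_sum)
    fix z1
    have "(\<Sum>z2\<in>{0..<p}. 2 - zero_ind p (z2 - z1) - zero_ind p (z2 + z1) * 2 + zero_ind p (z2 + z1) * zero_ind p (z2 - z1))
      = (\<Sum>z2\<in>{0..<p}. 2) - (\<Sum>z2\<in>{0..<p}. zero_ind p (z2 + (- z1))) - (\<Sum>z2\<in>{0..<p}. zero_ind p (z2 + z1)) * 2
        + (\<Sum>z2\<in>{0..<p}. zero_ind p (1 * z2 + z1) * zero_ind p (z2 + (- z1)))"
      by (simp add: sum.distrib sum_subtractf sum_distrib_right)
    also have "[\<dots> = 0 - 1 - 1 * 2 + zero_ind p (1 * (- z1) - z1)] (mod p)"
      by (intro cong_add cong_diff cong_mult cong_refl cong_sum_0 count_one_linear_cong count_two_monic_cong)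
    also have "zero_ind p (1 * (- z1) - z1) = zero_ind p (2 * z1 + 0)"
      using dvd_minus_iff[of p "2 * z1"] by (simp add: zero_ind_def)
    finally show "[(\<Sum>z2\<in>{0..<p}. 2 - zero_ind p (z2 - z1) - zero_ind p (z2 + z1) * 2 + zero_ind p (z2 + z1) * zero_ind p (z2 - z1))
      = - 3 + zero_ind p (2 * z1 + 0)] (mod p)" by simp
  qed
  also have "(\<Sum>z1\<in>{0..<p}. - 3 + zero_ind p (2 * z1 + 0)) = (\<Sum>z1\<in>{0..<p}. - 3) + (\<Sum>z1\<in>{0..<p}. zero_ind p (2 * z1 + 0))"
    by (rule sum.distrib)
  also have "[\<dots> = 0 + (1 - zero_ind p 2)] (mod p)"
    by (intro cong_add cong_sum_0 count_linear_cong)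
  finally show ?thesis by simp
qed

text \<open>In terms of the elementary symmetric polynomials \<open>e2, e3\<close> of \<open>z1, z2, z3\<close>, the two factors are
  \<open>e2 * z4 + e3\<close> and \<open>z4 + (z1 + z2 + z3)\<close>. Their resultant in \<open>z4\<close> is the product of the three
  sums \<open>zi + zj\<close>.\<close>

lemma count_cycle:
  "[(\<Sum>z1\<in>{0..<p}. \<Sum>z2\<in>{0..<p}. \<Sum>z3\<in>{0..<p}. \<Sum>z4\<in>{0..<p}.
      (1 - zero_ind p (z2 * z3 * z4 + z1 * z3 * z4 + z1 * z2 * z4 + z1 * z2 * z3)) * (1 - zero_ind p (cycle_K z1 z2 z3 z4)))
    = 1 - zero_ind p 2] (mod p)"
proof -
  define e2 where "e2 z1 z2 z3 = (z2 + z1) * z3 + z1 * z2" for z1 z2 z3 :: int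
  have z4: "[(\<Sum>z4\<in>{0..<p}.
      (1 - zero_ind p (z2 * z3 * z4 + z1 * z3 * z4 + z1 * z2 * z4 + z1 * z2 * z3)) * (1 - zero_ind p (cycle_K z1 z2 z3 z4)))
    = zero_ind p (e2 z1 z2 z3) - 2 + zero_ind p ((z2 + z1) * ((z3 + z1) * (z3 + z2)))] (mod p)" for z1 z2 z3
  proof -
    have e: "z2 * z3 * z4 + z1 * z3 * z4 + z1 * z2 * z4 + z1 * z2 * z3 = e2 z1 z2 z3 * z4 + z1 * z2 * z3"
      "cycle_K z1 z2 z3 z4 = z4 + (z1 + z2 + z3)" for z4
      by (simp_all add: e2_def cycle_K_def algebra_simps)
    have "(\<Sum>z4\<in>{0..<p}.
        (1 - zero_ind p (z2 * z3 * z4 + z1 * z3 * z4 + z1 * z2 * z4 + z1 * z2 * z3)) * (1 - zero_ind p (cycle_K z1 z2 z3 z4)))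
      = (\<Sum>z4\<in>{0..<p}. 1) - (\<Sum>z4\<in>{0..<p}. zero_ind p (e2 z1 z2 z3 * z4 + z1 * z2 * z3))
        - (\<Sum>z4\<in>{0..<p}. zero_ind p (z4 + (z1 + z2 + z3)))
        + (\<Sum>z4\<in>{0..<p}. zero_ind p (e2 z1 z2 z3 * z4 + z1 * z2 * z3) * zero_ind p (z4 + (z1 + z2 + z3)))"
      unfolding e by (simp add: sum.distrib sum_subtractf algebra_simps)
    also have "[\<dots> = 0 - (1 - zero_ind p (e2 z1 z2 z3)) - 1 + zero_ind p (e2 z1 z2 z3 * (z1 + z2 + z3) - z1 * z2 * z3)] (mod p)"
      by (intro cong_add cong_diff cong_sum_0 count_linear_cong count_one_linear_cong count_two_monic_cong)
    also have "e2 z1 z2 z3 * (z1 + z2 + z3) - z1 * z2 * z3 = (z2 + z1) * ((z3 + z1) * (z3 + z2))"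
      unfolding e2_def by Groebner_Basis.algebra
    finally show ?thesis by simp
  qed
  have e2: "[(\<Sum>z1\<in>{0..<p}. \<Sum>z2\<in>{0..<p}. \<Sum>z3\<in>{0..<p}. zero_ind p (e2 z1 z2 z3) - 2) = 0] (mod p)"
  proof -
    have "[(\<Sum>z3\<in>{0..<p}. zero_ind p (e2 z1 z2 z3) - 2) = (1 - zero_ind p (z2 + z1)) - 0] (mod p)" for z1 z2
      unfolding e2_def sum_subtractf by (intro cong_diff count_linear_cong cong_sum_0)
    then have "[(\<Sum>z1\<in>{0..<p}. \<Sum>z2\<in>{0..<p}. \<Sum>z3\<in>{0..<p}. zero_ind p (e2 z1 z2 z3) - 2)
        = (\<Sum>z1\<in>{0..<p}. \<Sum>z2\<in>{0..<p}. (1 - zero_ind p (z2 + z1)) - 0)] (mod p)"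
      by (intro cong_sum)
    also have "(\<Sum>z1\<in>{0..<p}. \<Sum>z2\<in>{0..<p}. (1 - zero_ind p (z2 + z1)) - 0)
        = (\<Sum>z1\<in>{0..<p}. (\<Sum>z2\<in>{0..<p}. 1) - (\<Sum>z2\<in>{0..<p}. zero_ind p (z2 + z1)))"
      by (simp only: sum_subtractf diff_0_right)
    also have "[\<dots> = (\<Sum>z1\<in>{0..<p}. 0 - 1)] (mod p)"
      by (intro cong_sum cong_diff cong_sum_0 count_one_linear_cong)
    also have "[(\<Sum>z1\<in>{0..<p}. 0 - 1) = 0] (mod p)" by (rule cong_sum_0)
    finally show ?thesis .
  qed
  have "[(\<Sum>z1\<in>{0..<p}. \<Sum>z2\<in>{0..<p}. \<Sum>z3\<in>{0..<p}. \<Sum>z4\<in>{0..<p}.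
      (1 - zero_ind p (z2 * z3 * z4 + z1 * z3 * z4 + z1 * z2 * z4 + z1 * z2 * z3)) * (1 - zero_ind p (cycle_K z1 z2 z3 z4)))
    = (\<Sum>z1\<in>{0..<p}. \<Sum>z2\<in>{0..<p}. \<Sum>z3\<in>{0..<p}.
        zero_ind p (e2 z1 z2 z3) - 2 + zero_ind p ((z2 + z1) * ((z3 + z1) * (z3 + z2))))] (mod p)"
    by (intro cong_sum z4)
  also have "(\<Sum>z1\<in>{0..<p}. \<Sum>z2\<in>{0..<p}. \<Sum>z3\<in>{0..<p}.
        zero_ind p (e2 z1 z2 z3) - 2 + zero_ind p ((z2 + z1) * ((z3 + z1) * (z3 + z2))))
    = (\<Sum>z1\<in>{0..<p}. \<Sum>z2\<in>{0..<p}. \<Sum>z3\<in>{0..<p}. zero_ind p (e2 z1 z2 z3) - 2)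
      + (\<Sum>z1\<in>{0..<p}. \<Sum>z2\<in>{0..<p}. \<Sum>z3\<in>{0..<p}. zero_ind p ((z2 + z1) * ((z3 + z1) * (z3 + z2))))"
    by (simp only: sum.distrib)
  also have "[\<dots> = 0 + (1 - zero_ind p 2)] (mod p)"
    by (intro cong_add e2 count_cayley)
  finally show ?thesis by simp
qed

end

section \<open>Spanning trees by deletion and contraction\<close>

text \<open>Spanning trees are enumerated by deciding for one edge after the other whether it belongs to the
  tree. The edges chosen so far form a forest, and whether a further edge closes a cycle can be
  read off from a labelling of its components.\<close>

definition joined :: "'v set set \<Rightarrow> ('v \<times> 'v) set" where
  "joined F = {(x, y). {x, y} \<in> F}\<^sup>*"

lemma joined_refl [simp]: "(x, x) \<in> joined F"
  by (simp add: joined_def)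

lemma joined_edge: "{x, y} \<in> F \<Longrightarrow> (x, y) \<in> joined F"
  by (auto simp: joined_def)

lemma joined_trans: "(x, y) \<in> joined F \<Longrightarrow> (y, z) \<in> joined F \<Longrightarrow> (x, z) \<in> joined F"
  by (simp add: joined_def)

lemma joined_sym: "(x, y) \<in> joined F \<Longrightarrow> (y, x) \<in> joined F"
  unfolding joined_def
  by (rule symD[OF sym_rtrancl]) (auto simp: sym_def insert_commute)

lemma joined_mono: "F \<subseteq> F' \<Longrightarrow> (x, y) \<in> joined F \<Longrightarrow> (x, y) \<in> joined F'"
  unfolding joined_def by (erule rtrancl_mono[THEN subsetD, rotated]) auto

lemma graph_connected_UNIV: "graph_connected UNIV F \<longleftrightarrow> (\<forall>x y. (x, y) \<in> joined F)"
  by (simp add: graph_connected_def joined_def)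

abbreviation forest :: "'v set set \<Rightarrow> bool" where
  "forest F \<equiv> (\<nexists>vs. graph_cycle F vs)"

lemma forest_subset: "forest F' \<Longrightarrow> F \<subseteq> F' \<Longrightarrow> forest F"
  unfolding graph_cycle_def by blast

text \<open>A path from \<open>u\<close> to \<open>v\<close> without repetitions, closed by the edge, is a cycle. It has at least three
  vertices because the edge itself is not in \<open>F\<close>.\<close>

lemma edge_closing_path_makes_cycle:
  assumes uv: "(u, v) \<in> joined F" and e: "{u, v} \<notin> F" and "u \<noteq> v"
  shows "\<not> forest (insert {u, v} F)"
proof -
  have "(\<lambda>x y. {x, y} \<in> F)\<^sup>*\<^sup>* u v"
    using uv by (simp add: joined_def rtrancl_def)
  then obtain xs0 where "rtrancl_path (\<lambda>x y. {x, y} \<in> F) u xs0 v"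
    by (auto simp: rtranclp_eq_rtrancl_path)
  then obtain xs where path: "rtrancl_path (\<lambda>x y. {x, y} \<in> F) u xs v" and dist: "distinct (u # xs)"
    by (rule rtrancl_path_distinct)
  have nonempty: "xs \<noteq> []" using path \<open>u \<noteq> v\<close> by (auto elim: rtrancl_path.cases)
  have last: "last xs = v" using path nonempty rtrancl_path_last by metis
  have step: "{(u # xs) ! i, xs ! i} \<in> F" if "i < length xs" for i
    using rtrancl_path_nth[OF path that] .
  have "length xs \<noteq> 1"
  proof
    assume "length xs = 1"
    then have "xs = [v]" using last by (cases xs) auto
    then show False using step[of 0] e by simp
  qed
  then have len: "length (u # xs) \<ge> 3" using nonempty by (cases xs rule: list.exhaust; cases "tl xs") auto
  have "{(u # xs) ! i, (u # xs) ! (Suc i mod length (u # xs))} \<in> insert {u, v} F"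
    if "i < length (u # xs)" for i
  proof (cases "i = length xs")
    case True
    then have "(u # xs) ! i = v" using last nonempty by (simp add: last_conv_nth nth_Cons')
    then show ?thesis using True by (simp add: insert_commute)
  next
    case False
    then show ?thesis using step[of i] that by simp
  qed
  then have "graph_cycle (insert {u, v} F) (u # xs)"
    using len dist by (simp only: graph_cycle_def simp_thms) blast
  then show ?thesis by blast
qed

text \<open>A cycle that is not in \<open>F\<close> uses the new edge, and exactly once; the rest of the cycle is
  a walk in \<open>F\<close> between the ends of that edge.\<close>

lemma forest_insert:
  assumes F: "forest F" and uv: "(u, v) \<notin> joined F"
  shows "forest (insert {u, v} F)"
proof
  assume "\<exists>vs. graph_cycle (insert {u, v} F) vs"
  then obtain vs where len: "length vs \<ge> 3" and dist: "distinct vs"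
    and cyc: "\<And>i. i < length vs \<Longrightarrow> {vs ! i, vs ! (Suc i mod length vs)} \<in> insert {u, v} F"
    unfolding graph_cycle_def by blast
  define n where "n = length vs"
  have "\<not> graph_cycle F vs" using F by blast
  then obtain i where i: "i < n" "{vs ! i, vs ! (Suc i mod n)} \<notin> F"
    using len dist unfolding graph_cycle_def n_def by blast
  then have e: "{vs ! i, vs ! (Suc i mod n)} = {u, v}" using cyc[of i] by (simp add: n_def)
  have other: "{vs ! j, vs ! (Suc j mod n)} \<in> F" if j: "j < n" "j \<noteq> i" for j
  proof -
    have nz: "0 < n" using i by simp
    have "{vs ! j, vs ! (Suc j mod n)} \<noteq> {vs ! i, vs ! (Suc i mod n)}"
    proof
      assume "{vs ! j, vs ! (Suc j mod n)} = {vs ! i, vs ! (Suc i mod n)}"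
      moreover have "vs ! j \<noteq> vs ! i" using dist j i by (simp add: n_def nth_eq_iff_index_eq)
      ultimately have "vs ! j = vs ! (Suc i mod n)" "vs ! (Suc j mod n) = vs ! i"
        by (auto simp: doubleton_eq_iff)
      then have *: "j = Suc i mod n" "Suc j mod n = i"
        using dist j i nz by (simp_all add: n_def nth_eq_iff_index_eq)
      have "Suc (Suc i) mod n = i" using * by (simp add: mod_Suc_eq)
      then show False using i len by (auto simp: n_def mod_Suc split: if_splits)
    qed
    then show ?thesis using cyc[of j] j e by (simp add: n_def)
  qed
  \<comment> \<open>Starting behind the new edge, the cycle is followed once around until its front end.\<close>
  have walk: "(vs ! (Suc i mod n), vs ! ((Suc i + k) mod n)) \<in> joined F" if "k < n" for k
    using that
  proof (induction k)
    case 0 show ?case by simp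
  next
    case (Suc k)
    let ?j = "(Suc i + k) mod n"
    have "?j \<noteq> i"
    proof
      assume "?j = i"
      moreover have "?j = (if Suc i + k < n then Suc i + k else Suc i + k - n)"
        using Suc.prems i by (simp add: mod_if)
      ultimately show False using Suc.prems by (auto split: if_splits)
    qed
    moreover have "?j < n" using i by simp
    ultimately have "{vs ! ?j, vs ! (Suc ?j mod n)} \<in> F" by (intro other)
    then have "(vs ! ?j, vs ! ((Suc i + Suc k) mod n)) \<in> joined F"
      by (intro joined_edge) (simp add: mod_Suc_eq)
    then show ?case using Suc by (auto intro: joined_trans)
  qed
  have "(Suc i + (n - 1)) mod n = i" using i by simp
  then have "(vs ! (Suc i mod n), vs ! i) \<in> joined F" using walk[of "n - 1"] i by simp
  then show False using uv e joined_sym[of _ _ F] by (auto simp: doubleton_eq_iff)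
qed

definition labels_components :: "('v \<Rightarrow> 'l) \<Rightarrow> 'v set set \<Rightarrow> bool" where
  "labels_components c F \<longleftrightarrow> (\<forall>x y. (x, y) \<in> joined F \<longleftrightarrow> c x = c y)"

definition relabel :: "'l \<Rightarrow> 'l \<Rightarrow> ('v \<Rightarrow> 'l) \<Rightarrow> 'v \<Rightarrow> 'l" where
  "relabel k l c x = (if c x = k then l else c x)"

lemma labels_components_insert:
  assumes c: "labels_components c F"
  shows "labels_components (relabel (c u) (c v) c) (insert {u, v} F)"
proof -
  let ?c = "relabel (c u) (c v) c" and ?F = "insert {u, v} F"
  have sound: "?c x = ?c y" if "(x, y) \<in> joined ?F" for x y
    using that unfolding joined_def
  proof (induction rule: rtrancl_induct)
    case base show ?case by simp
  next
    case (step y z)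
    have "c y = c z \<or> {y, z} = {u, v}"
      using step(2) c joined_edge[of y z F] by (auto simp: labels_components_def)
    then show ?case using step(3) by (auto simp: relabel_def doubleton_eq_iff)
  qed
  have uv: "(u, v) \<in> joined ?F" by (rule joined_edge) simp
  have same: "(x, y) \<in> joined ?F" if "c x = c y" for x y
    using that c joined_mono[of F ?F x y] by (auto simp: labels_components_def)
  have "(x, y) \<in> joined ?F" if "?c x = ?c y" for x y
  proof -
    consider "c x = c y" | "c x = c u" "c y = c v" | "c x = c v" "c y = c u"
      using \<open>?c x = ?c y\<close> by (auto simp: relabel_def split: if_splits)
    then show ?thesis
      by cases (metis same uv joined_trans joined_sym)+
  qed
  then show ?thesis using sound unfolding labels_components_def by blast
qed

text \<open>The recursion on the edges: deletion keeps the variable as a factor, contraction merges two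
  labels.\<close>

fun tree_sum :: "('v \<Rightarrow> 'l) \<Rightarrow> ('v \<times> 'v) list \<Rightarrow> ('v set \<Rightarrow> int) \<Rightarrow> int" where
  "tree_sum c [] a = of_bool (\<forall>x y. c x = c y)"
| "tree_sum c ((u, v) # es) a = a {u, v} * tree_sum c es a
     + (if c u = c v then 0 else tree_sum (relabel (c u) (c v) c) es a)"

abbreviation edge_set :: "('v \<times> 'v) list \<Rightarrow> 'v set set" where
  "edge_set es \<equiv> set (map (\<lambda>(u, v). {u, v}) es)"

text \<open>The invariant of the enumeration: \<open>F\<close> is the forest chosen so far, and \<open>tree_sum\<close> sums over the
  sets \<open>T\<close> of remaining edges that complete it to a spanning tree.\<close>

lemma tree_sum_completions:
  assumes "forest F" and "labels_components c F" and "F \<inter> edge_set es = {}"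
    and "distinct (map (\<lambda>(u, v). {u, v}) es)" and "\<forall>(u, v)\<in>set es. u \<noteq> v"
  shows "tree_sum c es a =
    (\<Sum>T | T \<subseteq> edge_set es \<and> graph_connected UNIV (F \<union> T) \<and> forest (F \<union> T). \<Prod>e\<in>edge_set es - T. a e)"
  using assms
proof (induction es arbitrary: c F)
  case Nil
  have "graph_connected UNIV F \<longleftrightarrow> (\<forall>x y. c x = c y)"
    using Nil(2) by (simp add: graph_connected_UNIV labels_components_def)
  moreover have "{T. T \<subseteq> edge_set [] \<and> graph_connected UNIV (F \<union> T) \<and> forest (F \<union> T)}
      = (if graph_connected UNIV F then {{}} else {})"
    using Nil(1) by auto
  ultimately show ?case by simp
next
  case (Cons uv es)
  obtain u v where uv: "uv = (u, v)" by (cases uv)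
  let ?e = "{u, v}" and ?E = "edge_set es"
  let ?ok = "\<lambda>F T. graph_connected UNIV (F \<union> T) \<and> forest (F \<union> T)"
  have e: "?e \<notin> F" "?e \<notin> ?E" and "u \<noteq> v" and disj: "F \<inter> ?E = {}"
    using Cons.prems by (auto simp: uv)
  have dist: "distinct (map (\<lambda>(u, v). {u, v}) es)" and loops: "\<forall>(u, v)\<in>set es. u \<noteq> v"
    using Cons.prems by auto
  have without: "tree_sum c es a = (\<Sum>T | T \<subseteq> ?E \<and> ?ok F T. \<Prod>e\<in>?E - T. a e)"
    by (rule Cons.IH[OF Cons.prems(1,2) disj dist loops])
  have "with": "(if c u = c v then 0 else tree_sum (relabel (c u) (c v) c) es a)
      = (\<Sum>T | T \<subseteq> ?E \<and> ?ok (insert ?e F) T. \<Prod>e\<in>?E - T. a e)"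
  proof (cases "c u = c v")
    case True
    then have "(u, v) \<in> joined F" using Cons.prems(2) by (simp add: labels_components_def)
    then have cycle: "\<not> forest (insert ?e F)"
      by (rule edge_closing_path_makes_cycle[OF _ e(1) \<open>u \<noteq> v\<close>])
    have "\<not> forest (insert ?e F \<union> T)" for T
      using cycle forest_subset[OF _ Un_upper1] by metis
    then have none: "{T. T \<subseteq> ?E \<and> ?ok (insert ?e F) T} = {}" by auto
    show ?thesis unfolding none using True by simp
  next
    case False
    then have "(u, v) \<notin> joined F" using Cons.prems(2) by (simp add: labels_components_def)
    then have "forest (insert ?e F)" using Cons.prems(1) by (intro forest_insert)
    moreover have "insert ?e F \<inter> ?E = {}" using disj e by simp
    ultimately show ?thesis
      using False Cons.IH[OF _ labels_components_insert[OF Cons.prems(2)] _ dist loops] by simp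
  qed
  have split: "{T. T \<subseteq> insert ?e ?E \<and> ?ok F T}
      = {T. T \<subseteq> ?E \<and> ?ok F T} \<union> insert ?e ` {T. T \<subseteq> ?E \<and> ?ok (insert ?e F) T}" (is "?A = ?B \<union> ?C")
  proof (intro equalityI subsetI)
    fix T assume T: "T \<in> ?A"
    show "T \<in> ?B \<union> ?C"
    proof (cases "?e \<in> T")
      case True
      then have "T = insert ?e (T - {?e})" "F \<union> T = insert ?e F \<union> (T - {?e})" by auto
      moreover have "T - {?e} \<subseteq> ?E" using T by auto
      ultimately have "T - {?e} \<in> {T. T \<subseteq> ?E \<and> ?ok (insert ?e F) T}" using T by simp
      then show ?thesis using \<open>T = insert ?e (T - {?e})\<close> by blast
    next
      case False
      then show ?thesis using T by auto
    qed
  next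
    fix T assume "T \<in> ?B \<union> ?C"
    then show "T \<in> ?A"
    proof (elim UnE imageE)
      fix T' assume T: "T = insert ?e T'" and T': "T' \<in> {T. T \<subseteq> ?E \<and> ?ok (insert ?e F) T}"
      have "F \<union> T = insert ?e F \<union> T'" by (simp add: T)
      moreover have "T \<subseteq> insert ?e ?E" using T T' by blast
      ultimately show ?thesis using T' by simp
    qed blast
  qed
  have inj: "inj_on (insert ?e) {T. T \<subseteq> ?E \<and> ?ok (insert ?e F) T}"
  proof (rule inj_onI)
    fix T T' assume "T \<in> {T. T \<subseteq> ?E \<and> ?ok (insert ?e F) T}" "T' \<in> {T. T \<subseteq> ?E \<and> ?ok (insert ?e F) T}"
      and eq: "insert ?e T = insert ?e T'"
    then have "?e \<notin> T" "?e \<notin> T'" using e(2) by blast+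
    then show "T = T'" using eq insert_ident[of ?e T T'] by iprover
  qed
  have fin: "finite {T. T \<subseteq> ?E \<and> P T}" for P
    by (rule finite_subset[of _ "Pow ?E"]) auto
  have "?B \<inter> ?C = {}" using e(2) by blast
  then have "(\<Sum>T | T \<subseteq> insert ?e ?E \<and> ?ok F T. \<Prod>e\<in>insert ?e ?E - T. a e)
      = (\<Sum>T | T \<subseteq> ?E \<and> ?ok F T. \<Prod>e\<in>insert ?e ?E - T. a e)
        + (\<Sum>T\<in>insert ?e ` {T. T \<subseteq> ?E \<and> ?ok (insert ?e F) T}. \<Prod>e\<in>insert ?e ?E - T. a e)"
    unfolding split by (intro sum.union_disjoint finite_imageI fin)
  also have "(\<Sum>T | T \<subseteq> ?E \<and> ?ok F T. \<Prod>e\<in>insert ?e ?E - T. a e)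
      = (\<Sum>T | T \<subseteq> ?E \<and> ?ok F T. a ?e * (\<Prod>e\<in>?E - T. a e))"
  proof (intro sum.cong refl)
    fix T assume "T \<in> {T. T \<subseteq> ?E \<and> ?ok F T}"
    then have "insert ?e ?E - T = insert ?e (?E - T)" using e by auto
    then show "(\<Prod>e\<in>insert ?e ?E - T. a e) = a ?e * (\<Prod>e\<in>?E - T. a e)" using e by simp
  qed
  also have "\<dots> = a ?e * tree_sum c es a" by (simp only: without sum_distrib_left)
  also have "(\<Sum>T\<in>insert ?e ` {T. T \<subseteq> ?E \<and> ?ok (insert ?e F) T}. \<Prod>e\<in>insert ?e ?E - T. a e)
      = (\<Sum>T | T \<subseteq> ?E \<and> ?ok (insert ?e F) T. \<Prod>e\<in>?E - T. a e)"
    unfolding sum.reindex[OF inj] o_def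
  proof (intro sum.cong refl arg_cong2[where f = prod])
    fix T assume "T \<in> {T. T \<subseteq> ?E \<and> ?ok (insert ?e F) T}"
    then show "insert ?e ?E - insert ?e T = ?E - T" using e by auto
  qed
  also have "\<dots> = (if c u = c v then 0 else tree_sum (relabel (c u) (c v) c) es a)" by (simp only: "with")
  finally show ?case by (simp add: uv)
qed

lemma spanning_trees_sum:
  assumes "distinct (map (\<lambda>(u, v). {u, v}) es)" and "\<forall>(u, v)\<in>set es. u \<noteq> v"
  shows "(\<Sum>T\<in>spanning_trees UNIV (edge_set es). \<Prod>e\<in>edge_set es - T. a e) = tree_sum (\<lambda>x. x) es a"
proof -
  have "forest {}" by (auto simp: graph_cycle_def intro!: exI[of _ "0::nat"])
  moreover have "labels_components (\<lambda>x. x) {}" by (simp add: labels_components_def joined_def)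
  ultimately have "tree_sum (\<lambda>x. x) es a = (\<Sum>T | T \<subseteq> edge_set es \<and>
      graph_connected UNIV ({} \<union> T) \<and> forest ({} \<union> T). \<Prod>e\<in>edge_set es - T. a e)"
    by (rule tree_sum_completions[OF _ _ _ assms]) simp
  then show ?thesis by (simp add: spanning_trees_def)
qed

section \<open>The graph polynomial of XStrip\<close>

text \<open>Labellings of the eight vertices as explicit tuples, so that rewriting can run the
  recursion.\<close>

type_synonym labelling =
  "xstrip_vertex \<times> xstrip_vertex \<times> xstrip_vertex \<times> xstrip_vertex \<times>
   xstrip_vertex \<times> xstrip_vertex \<times> xstrip_vertex \<times> xstrip_vertex"

fun label_of :: "labelling \<Rightarrow> xstrip_vertex \<Rightarrow> xstrip_vertex" where
  "label_of (t0, t1, t2, t3, b0, b1, b2, b3) T0 = t0"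
| "label_of (t0, t1, t2, t3, b0, b1, b2, b3) T1 = t1"
| "label_of (t0, t1, t2, t3, b0, b1, b2, b3) T2 = t2"
| "label_of (t0, t1, t2, t3, b0, b1, b2, b3) T3 = t3"
| "label_of (t0, t1, t2, t3, b0, b1, b2, b3) B0 = b0"
| "label_of (t0, t1, t2, t3, b0, b1, b2, b3) B1 = b1"
| "label_of (t0, t1, t2, t3, b0, b1, b2, b3) B2 = b2"
| "label_of (t0, t1, t2, t3, b0, b1, b2, b3) B3 = b3"

fun merge_labels :: "xstrip_vertex \<Rightarrow> xstrip_vertex \<Rightarrow> labelling \<Rightarrow> labelling" where
  "merge_labels k l (t0, t1, t2, t3, b0, b1, b2, b3) =
     (if t0 = k then l else t0, if t1 = k then l else t1, if t2 = k then l else t2, if t3 = k then l else t3,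
      if b0 = k then l else b0, if b1 = k then l else b1, if b2 = k then l else b2, if b3 = k then l else b3)"

lemma relabel_label_of: "relabel k l (label_of t) = label_of (merge_labels k l t)"
proof
  fix x show "relabel k l (label_of t) x = label_of (merge_labels k l t) x"
    by (cases "(t, x)" rule: label_of.cases) (simp_all add: relabel_def)
qed

lemma label_of_id: "(\<lambda>x. x) = label_of (T0, T1, T2, T3, B0, B1, B2, B3)"
proof
  fix x show "x = label_of (T0, T1, T2, T3, B0, B1, B2, B3) x" by (cases x) simp_all
qed

lemma all_xstrip_vertex: "(\<forall>x. P x) \<longleftrightarrow> P T0 \<and> P T1 \<and> P T2 \<and> P T3 \<and> P B0 \<and> P B1 \<and> P B2 \<and> P B3"
  using xstrip_vertex.exhaust by metis

lemma tree_sum_label_of_Nil: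
  "tree_sum (label_of (t0, t1, t2, t3, b0, b1, b2, b3)) [] a =
     (if t1 = t0 \<and> t2 = t0 \<and> t3 = t0 \<and> b0 = t0 \<and> b1 = t0 \<and> b2 = t0 \<and> b3 = t0 then 1 else 0)"
  by (auto simp: all_xstrip_vertex)

lemma tree_sum_label_of_Cons:
  "tree_sum (label_of t) ((u, v) # es) a = a {u, v} * tree_sum (label_of t) es a
     + (if label_of t u = label_of t v then 0
        else tree_sum (label_of (merge_labels (label_of t u) (label_of t v) t)) es a)"
  by (simp add: relabel_label_of)

text \<open>Within a gadget the edges are listed in the order in which \<open>gadget_sum_edges\<close> sums over them.\<close>

definition left_edges :: "(xstrip_vertex \<times> xstrip_vertex) list" where
  "left_edges = [(T0, T1), (B0, T2), (T0, B2), (B0, B1), (T0, B0)]"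

definition right_edges :: "(xstrip_vertex \<times> xstrip_vertex) list" where
  "right_edges = [(B3, T1), (T3, T2), (B3, B2), (T3, B1), (B3, T3)]"

definition cycle_edges :: "(xstrip_vertex \<times> xstrip_vertex) list" where
  "cycle_edges = [(T1, T2), (T2, B2), (B2, B1), (B1, T1)]"

text \<open>Deletion and contraction yields the graph polynomial with its 1280 monomials as a nested
  expression. That it agrees with the pencil is then an identity in the polynomial ring.\<close>

lemma tree_sum_xstrip:
  fixes a :: "xstrip_vertex set \<Rightarrow> int"
  defines "z1 \<equiv> a {T1, T2}" and "z2 \<equiv> a {T2, B2}" and "z3 \<equiv> a {B2, B1}" and "z4 \<equiv> a {B1, T1}"
    and "p1 \<equiv> a {B3, T1}" and "q2 \<equiv> a {T3, T2}" and "p3 \<equiv> a {B3, B2}" and "q4 \<equiv> a {T3, B1}" and "m \<equiv> a {B3, T3}"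
    and "x1 \<equiv> a {T0, T1}" and "y2 \<equiv> a {B0, T2}" and "x3 \<equiv> a {T0, B2}" and "y4 \<equiv> a {B0, B1}" and "n \<equiv> a {T0, B0}"
  defines "E \<equiv> cycle_K z1 z2 z3 z4" and "N \<equiv> cycle_N z1 z2 z3 z4"
    and "M \<equiv> cycle_M z1 z2 z3 z4" and "T \<equiv> cycle_T z1 z2 z3 z4"
    and "R \<equiv> (p1 + p3, q2 + q4, m + p1 + q2, 0, p1, - q2)"
    and "D \<equiv> (x1 + x3, y2 + y4, n + x1 + y2, 0, x1, - y2)"
  shows "tree_sum (\<lambda>x. x) (left_edges @ right_edges @ cycle_edges) a
    = pencil (pencil E N M T R) (attach_N N M T R) (attach_M M T R) (T * det3 R) D"
proof -
  have "tree_sum (\<lambda>x. x) (left_edges @ right_edges @ cycle_edges) a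
    = tree_sum (label_of (T0, T1, T2, T3, B0, B1, B2, B3))
       [(T0, T1), (B0, T2), (T0, B2), (B0, B1), (T0, B0), (B3, T1), (T3, T2), (B3, B2), (T3, B1), (B3, T3),
        (T1, T2), (T2, B2), (B2, B1), (B1, T1)] a"
    unfolding label_of_id left_edges_def right_edges_def cycle_edges_def by simp
  also have "\<dots> = pencil (pencil E N M T R) (attach_N N M T R) (attach_M M T R) (T * det3 R) D"
    \<comment> \<open>With \<open>if_weak_cong\<close> a branch is entered only once its condition is decided; edges inside a
       component close a cycle and are pruned.\<close>
    apply (simp only: tree_sum_label_of_Nil tree_sum_label_of_Cons label_of.simps merge_labels.simps
      xstrip_vertex.distinct if_True if_False refl simp_thms
      mult_zero_right add_0_left add_0_right mult_1_right cong: if_weak_cong)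
    apply (fold z1_def z2_def z3_def z4_def p1_def p3_def q2_def q4_def m_def x1_def x3_def y2_def y4_def n_def)
    apply (simp only: R_def D_def E_def N_def M_def T_def cycle_defs pencil_def attach_N_def attach_M_def sym3_simps)
    apply Groebner_Basis.algebra
    done
  finally show ?thesis .
qed

text \<open>Sums over all functions on a finite set of edges, as sums over one value after the other.\<close>

fun iterated_sum :: "'e list \<Rightarrow> 'b set \<Rightarrow> (('e \<Rightarrow> 'b) \<Rightarrow> int) \<Rightarrow> int" where
  "iterated_sum [] I G = G (\<lambda>_. undefined)"
| "iterated_sum (e # es) I G = (\<Sum>x\<in>I. iterated_sum es I (\<lambda>b. G (b(e := x))))"

lemma sum_PiE_eq_iterated_sum:
  "distinct es \<Longrightarrow> (\<Sum>b\<in>set es \<rightarrow>\<^sub>E I. G b) = iterated_sum es I G"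
proof (induction es arbitrary: G)
  case Nil then show ?case by simp
next
  case (Cons e es)
  have "(\<Sum>b\<in>set (e # es) \<rightarrow>\<^sub>E I. G b)
      = (\<Sum>(x, b)\<in>I \<times> (set es \<rightarrow>\<^sub>E I). G (b(e := x)))"
    unfolding list.set PiE_insert_eq using Cons.prems
    by (subst sum.reindex) (auto intro!: inj_combinator sum.cong)
  then show ?case using Cons by (simp flip: sum.cartesian_product)
qed

section \<open>Fields of prime order\<close>

context field
begin

text \<open>The unique ring homomorphism from the integers.\<close>

definition int_image :: "int \<Rightarrow> 'a" where
  "int_image n = add_pow R n \<one>"

lemma int_image_closed [simp]: "int_image n \<in> carrier R"
  by (simp add: int_image_def)

lemma int_image_add: "int_image (m + n) = int_image m \<oplus> int_image n"
  unfolding int_image_def by (rule add.int_pow_mult) simp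

lemma int_image_mult: "int_image (m * n) = int_image m \<otimes> int_image n"
proof -
  have "int_image m \<otimes> int_image n = add_pow R m (\<one> \<otimes> add_pow R n \<one>)"
    unfolding int_image_def by (rule add_pow_ldistr_int) simp_all
  also have "\<dots> = add_pow R (n * m) \<one>"
    by (simp add: add.int_pow_pow)
  finally show ?thesis by (simp add: int_image_def mult.commute)
qed

lemma int_image_0 [simp]: "int_image 0 = \<zero>" and int_image_1 [simp]: "int_image 1 = \<one>"
  using add.int_pow_1[of \<one>] by (simp_all add: int_image_def add_pow_int_ge)

lemma int_image_sum: "finite A \<Longrightarrow> int_image (sum f A) = (\<Oplus>x\<in>A. int_image (f x))"
  by (induction A rule: finite_induct) (simp_all add: int_image_add)

lemma int_image_prod: "finite A \<Longrightarrow> int_image (prod f A) = (\<Otimes>x\<in>A. int_image (f x))"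
  by (induction A rule: finite_induct) (simp_all add: int_image_mult)

text \<open>In a field with \<open>p\<close> elements the kernel is \<open>p\<close> times the integers, so the image has \<open>p\<close> elements
  and is the whole field. Points over such a field thus correspond to integer points modulo \<open>p\<close>.\<close>

lemma int_image_prime_order:
  assumes card: "card (carrier R) = p" and p: "prime p"
  shows int_image_eq_0_iff: "int_image n = \<zero> \<longleftrightarrow> int p dvd n"
    and bij_betw_int_image: "bij_betw int_image {0..<int p} (carrier R)"
proof -
  have fin: "finite (carrier R)" using card p by (metis card.infinite not_prime_0)
  have "add_pow R (order (add_monoid R)) \<one> = \<zero>"
    using add.pow_order_eq_1[of \<one>] by simp
  then have p0: "int_image (int p) = \<zero>"
    using card by (simp add: int_image_def order_def add_pow_int_ge)
  show iff: "int_image n = \<zero> \<longleftrightarrow> int p dvd n" for n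
  proof
    assume "int p dvd n"
    then show "int_image n = \<zero>" using p0 by (auto simp: int_image_mult)
  next
    assume n: "int_image n = \<zero>"
    show "int p dvd n"
    proof (rule ccontr)
      assume "\<not> int p dvd n"
      then have "coprime (int p) n" using p by (simp add: prime_imp_coprime)
      then obtain u v where "u * int p + v * n = 1"
        using bezout_int[of "int p" n] by (auto simp: coprime_iff_gcd_eq_1)
      then have "\<one> = int_image u \<otimes> int_image (int p) \<oplus> int_image v \<otimes> int_image n"
        by (metis int_image_1 int_image_add int_image_mult)
      then show False using n p0 by simp
    qed
  qed
  have inj: "inj_on int_image {0..<int p}"
  proof (rule inj_onI)
    fix m n assume m: "m \<in> {0..<int p}" and n: "n \<in> {0..<int p}" and eq: "int_image m = int_image n"
    have "int_image m = int_image (m - n) \<oplus> int_image n" by (simp flip: int_image_add)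
    then have "int_image (m - n) = \<zero>" using eq by simp
    then have "m mod int p = n mod int p" by (simp add: iff mod_eq_dvd_iff)
    then show "m = n" using m n by simp
  qed
  have "int_image ` {0..<int p} = carrier R"
    by (rule card_subset_eq[OF fin]) (auto simp: card_image[OF inj] card)
  then show "bij_betw int_image {0..<int p} (carrier R)" using inj by (simp add: bij_betw_def)
qed

lemma card_graph_hypersurface:
  fixes E :: "'v set set"
  assumes card: "card (carrier R) = p" and p: "prime p" and E: "finite E"
  shows "card (graph_hypersurface R V E) =
    card {b \<in> E \<rightarrow>\<^sub>E {0..<int p}. int p dvd (\<Sum>T\<in>spanning_trees V E. \<Prod>e\<in>E - T. b e)}"
proof -
  note bij = bij_betw_int_image[OF card p]
  define lift where "lift b = (\<lambda>e\<in>E. int_image (b e))" for b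
  have "spanning_trees V E \<subseteq> Pow E" by (auto simp: spanning_trees_def)
  then have fin: "finite (spanning_trees V E)" using E by (meson finite_Pow_iff finite_subset)
  have eval: "mpoly_eval R (lift b) (graph_poly V E)
      = int_image (\<Sum>T\<in>spanning_trees V E. \<Prod>e\<in>E - T. b e)" for b
  proof -
    have "mpoly_eval R (lift b) (graph_poly V E) = (\<Oplus>T\<in>spanning_trees V E. \<Otimes>e\<in>E - T. lift b e)"
      by (rule mpoly_eval_graph_poly) (use E in \<open>auto simp: lift_def is_cring\<close>)
    also have "\<dots> = (\<Oplus>T\<in>spanning_trees V E. int_image (\<Prod>e\<in>E - T. b e))"
    proof (rule finsum_cong')
      fix T
      show "(\<Otimes>e\<in>E - T. lift b e) = int_image (\<Prod>e\<in>E - T. b e)"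
        unfolding int_image_prod[OF finite_Diff[OF E]] by (rule finprod_cong') (auto simp: lift_def)
    qed auto
    also have "\<dots> = int_image (\<Sum>T\<in>spanning_trees V E. \<Prod>e\<in>E - T. b e)"
      by (simp only: int_image_sum[OF fin])
    finally show ?thesis .
  qed
  have lift: "bij_betw lift (E \<rightarrow>\<^sub>E {0..<int p}) (E \<rightarrow>\<^sub>E carrier R)"
  proof (rule bij_betw_byWitness[where f' = "\<lambda>a. \<lambda>e\<in>E. inv_into {0..<int p} int_image (a e)"])
    show "\<forall>b\<in>E \<rightarrow>\<^sub>E {0..<int p}. (\<lambda>e\<in>E. inv_into {0..<int p} int_image (lift b e)) = b"
      using bij_betw_inv_into_left[OF bij]
      by (auto simp: lift_def fun_eq_iff PiE_def Pi_iff extensional_def)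
    show "\<forall>a\<in>E \<rightarrow>\<^sub>E carrier R. lift (\<lambda>e\<in>E. inv_into {0..<int p} int_image (a e)) = a"
      using bij_betw_inv_into_right[OF bij]
      by (auto simp: lift_def fun_eq_iff PiE_def Pi_iff extensional_def)
    show "lift ` (E \<rightarrow>\<^sub>E {0..<int p}) \<subseteq> E \<rightarrow>\<^sub>E carrier R" by (auto simp: lift_def)
    show "(\<lambda>a. \<lambda>e\<in>E. inv_into {0..<int p} int_image (a e)) ` (E \<rightarrow>\<^sub>E carrier R) \<subseteq> E \<rightarrow>\<^sub>E {0..<int p}"
      using bij_betwE[OF bij_betw_inv_into[OF bij]] by (auto simp: PiE_iff simp del: atLeastLessThan_iff)
  qed
  have "bij_betw lift {b \<in> E \<rightarrow>\<^sub>E {0..<int p}. int p dvd (\<Sum>T\<in>spanning_trees V E. \<Prod>e\<in>E - T. b e)}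
      (graph_hypersurface R V E)"
    unfolding bij_betw_def
  proof
    show "inj_on lift {b \<in> E \<rightarrow>\<^sub>E {0..<int p}. int p dvd (\<Sum>T\<in>spanning_trees V E. \<Prod>e\<in>E - T. b e)}"
      using lift by (auto simp: bij_betw_def intro: inj_on_subset)
    have "graph_hypersurface R V E = {a \<in> lift ` (E \<rightarrow>\<^sub>E {0..<int p}). mpoly_eval R a (graph_poly V E) = \<zero>}"
      using lift by (simp add: graph_hypersurface_def bij_betw_def)
    also have "\<dots> = lift ` {b \<in> E \<rightarrow>\<^sub>E {0..<int p}. mpoly_eval R (lift b) (graph_poly V E) = \<zero>}" by blast
    finally show "lift ` {b \<in> E \<rightarrow>\<^sub>E {0..<int p}. int p dvd (\<Sum>T\<in>spanning_trees V E. \<Prod>e\<in>E - T. b e)}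
        = graph_hypersurface R V E"
      by (simp only: eval int_image_eq_0_iff[OF card p])
  qed
  then show ?thesis by (rule bij_betw_same_card[symmetric])
qed

end

lemma GF_prime:
  assumes "prime p"
  shows "field (GF p)" and "card (carrier (GF p)) = p"
proof -
  interpret residues_prime p "residue_ring (int p)"
    using assms by unfold_locales simp_all
  have "field (residue_ring (int p)) \<and> finite (carrier (residue_ring (int p)))
      \<and> card (carrier (residue_ring (int p))) = p"
    using is_field by (simp add: residue_ring_def prime_gt_0_nat[OF assms])
  then have "field (GF p) \<and> finite (carrier (GF p)) \<and> card (carrier (GF p)) = p"
    unfolding GF_def by (rule someI)
  then show "field (GF p)" and "card (carrier (GF p)) = p" by simp_all
qed

section \<open>The number of points modulo the cube of the prime\<close>

lemma edge_set_xstrip: "edge_set (left_edges @ right_edges @ cycle_edges) = xstrip_edges"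
  by (auto simp: left_edges_def right_edges_def cycle_edges_def xstrip_edges_def insert_commute)

lemma distinct_xstrip:
  "distinct (map (\<lambda>(u, v). {u, v}) (left_edges @ right_edges @ cycle_edges))"
  "distinct (map (\<lambda>(u, v). {u, v}) (cycle_edges @ right_edges @ left_edges))"
  "\<forall>(u, v)\<in>set (left_edges @ right_edges @ cycle_edges). u \<noteq> v"
  by (simp_all add: left_edges_def right_edges_def cycle_edges_def doubleton_eq_iff)

lemma cong_entry12_attach_N:
  assumes "[u = u'] (mod p)" "[v = v'] (mod p)" "[s = s'] (mod p)" "[t = t'] (mod p)" "[y = y'] (mod p)"
  shows "[entry12 (attach_N N M T (u, v, y, d, s, t)) = entry12 (attach_N N M T (u', v', y', d, s', t'))] (mod p)"
  using assms unfolding attach_N_def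
  by (cases N; cases M) (auto intro!: cong_poly)

context prime_modulus
begin

text \<open>The first gadget is summed out by \<open>gadget_sum_pencil\<close>, where the coherent network is the
  four-cycle with the second gadget; the remaining sum over the second gadget is only needed
  modulo \<open>p\<close>.\<close>

lemma count_both_gadgets:
  fixes z1 z2 z3 z4
  defines "E \<equiv> cycle_K z1 z2 z3 z4" and "N \<equiv> cycle_N z1 z2 z3 z4"
    and "M \<equiv> cycle_M z1 z2 z3 z4" and "T \<equiv> cycle_T z1 z2 z3 z4"
  defines "R p1 q2 p3 q4 m \<equiv> (p1 + p3, q2 + q4, m + p1 + q2, 0, p1, - q2)"
  shows "[(\<Sum>p1\<in>{0..<p}. \<Sum>q2\<in>{0..<p}. \<Sum>p3\<in>{0..<p}. \<Sum>q4\<in>{0..<p}. \<Sum>m\<in>{0..<p}.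
      \<Sum>x1\<in>{0..<p}. \<Sum>y2\<in>{0..<p}. \<Sum>x3\<in>{0..<p}. \<Sum>y4\<in>{0..<p}. \<Sum>n\<in>{0..<p}.
        zero_ind p (pencil (pencil E N M T (R p1 q2 p3 q4 m)) (attach_N N M T (R p1 q2 p3 q4 m))
          (attach_M M T (R p1 q2 p3 q4 m)) (T * det3 (R p1 q2 p3 q4 m))
          (x1 + x3, y2 + y4, n + x1 + y2, 0, x1, - y2)))
    = - (p\<^sup>2 * gadget_sum (\<lambda>f g k l h. (1 - zero_ind p (pencil E N M T (f, g, h, 0, k, l)))
                * zero_ind p (entry12 (attach_N N M T (f, g, h, 0, k, l)))))] (mod p ^ 3)"
proof -
  define H where "H f g k l h = - (p\<^sup>2 * ((1 - zero_ind p (pencil E N M T (f, g, h, 0, k, l)))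
                * zero_ind p (entry12 (attach_N N M T (f, g, h, 0, k, l)))))" for f g k l h
  have H: "periodic5_mod p H"
    unfolding periodic5_mod_def H_def
    by (intro allI impI arg_cong[where f = uminus] arg_cong2[where f = times] arg_cong2[where f = minus] refl
        periodic5_modD[OF periodic5_mod_zero_ind_pencil] cong_refl zero_ind_cong)
      (assumption | rule cong_entry12_attach_N)+
  have inner: "[(\<Sum>x1\<in>{0..<p}. \<Sum>y2\<in>{0..<p}. \<Sum>x3\<in>{0..<p}. \<Sum>y4\<in>{0..<p}. \<Sum>n\<in>{0..<p}.
        zero_ind p (pencil (pencil E N M T (f, g, h, 0, k, l)) (attach_N N M T (f, g, h, 0, k, l))
          (attach_M M T (f, g, h, 0, k, l)) (T * det3 (f, g, h, 0, k, l))
          (x1 + x3, y2 + y4, n + x1 + y2, 0, x1, - y2)))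
      = H f g k l h] (mod p ^ 3)" for f g k l h
  proof -
    obtain a b c d e i where n: "attach_N N M T (f, g, h, 0, k, l) = (a, b, c, d, e, i)"
      by (cases "attach_N N M T (f, g, h, 0, k, l)")
    have coh: "coherent (pencil E N M T (f, g, h, 0, k, l)) (a, b, c, d, e, i)
        (attach_M M T (f, g, h, 0, k, l)) (T * det3 (f, g, h, 0, k, l))"
      using coherent_attach_cycle[of z1 z2 z3 z4 f g h k l] n unfolding E_def N_def M_def T_def by simp
    show ?thesis
      unfolding H_def n entry12.simps gadget_sum_edges[OF periodic5_mod_zero_ind_pencil] by (rule gadget_sum_pencil[OF coh])
  qed
  have "[(\<Sum>p1\<in>{0..<p}. \<Sum>q2\<in>{0..<p}. \<Sum>p3\<in>{0..<p}. \<Sum>q4\<in>{0..<p}. \<Sum>m\<in>{0..<p}.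
      \<Sum>x1\<in>{0..<p}. \<Sum>y2\<in>{0..<p}. \<Sum>x3\<in>{0..<p}. \<Sum>y4\<in>{0..<p}. \<Sum>n\<in>{0..<p}.
        zero_ind p (pencil (pencil E N M T (R p1 q2 p3 q4 m)) (attach_N N M T (R p1 q2 p3 q4 m))
          (attach_M M T (R p1 q2 p3 q4 m)) (T * det3 (R p1 q2 p3 q4 m))
          (x1 + x3, y2 + y4, n + x1 + y2, 0, x1, - y2)))
    = (\<Sum>p1\<in>{0..<p}. \<Sum>q2\<in>{0..<p}. \<Sum>p3\<in>{0..<p}. \<Sum>q4\<in>{0..<p}. \<Sum>m\<in>{0..<p}.
        H (p1 + p3) (q2 + q4) p1 (- q2) (m + p1 + q2))] (mod p ^ 3)"
    unfolding R_def by (intro cong_sum inner)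
  also have "(\<Sum>p1\<in>{0..<p}. \<Sum>q2\<in>{0..<p}. \<Sum>p3\<in>{0..<p}. \<Sum>q4\<in>{0..<p}. \<Sum>m\<in>{0..<p}.
        H (p1 + p3) (q2 + q4) p1 (- q2) (m + p1 + q2)) = gadget_sum H"
    by (rule gadget_sum_edges[OF H])
  finally show ?thesis unfolding H_def by (simp only: sum_negf sum_distrib_left)
qed

lemma count_xstrip:
  "[(\<Sum>b\<in>xstrip_edges \<rightarrow>\<^sub>E {0..<p}. zero_ind p (\<Sum>T\<in>spanning_trees UNIV xstrip_edges. \<Prod>e\<in>xstrip_edges - T. b e))
    = - (p\<^sup>2 * (1 - zero_ind p 2))] (mod p ^ 3)"
proof -
  define S where "S z1 z2 z3 z4 = gadget_sum (\<lambda>f g k l h.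
      (1 - zero_ind p (pencil (cycle_K z1 z2 z3 z4) (cycle_N z1 z2 z3 z4) (cycle_M z1 z2 z3 z4) (cycle_T z1 z2 z3 z4) (f, g, h, 0, k, l)))
      * zero_ind p (entry12 (attach_N (cycle_N z1 z2 z3 z4) (cycle_M z1 z2 z3 z4) (cycle_T z1 z2 z3 z4) (f, g, h, 0, k, l))))"
    for z1 z2 z3 z4
  have set: "set (map (\<lambda>(u, v). {u, v}) (cycle_edges @ right_edges @ left_edges)) = xstrip_edges"
    using edge_set_xstrip by (simp add: Un_ac)
  have "(\<Sum>b\<in>xstrip_edges \<rightarrow>\<^sub>E {0..<p}. zero_ind p (\<Sum>T\<in>spanning_trees UNIV xstrip_edges. \<Prod>e\<in>xstrip_edges - T. b e))
      = (\<Sum>b\<in>xstrip_edges \<rightarrow>\<^sub>E {0..<p}. zero_ind p (tree_sum (\<lambda>x. x) (left_edges @ right_edges @ cycle_edges) b))"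
    unfolding edge_set_xstrip[symmetric] spanning_trees_sum[OF distinct_xstrip(1,3)] ..
  also have "\<dots> = iterated_sum (map (\<lambda>(u, v). {u, v}) (cycle_edges @ right_edges @ left_edges)) {0..<p}
      (\<lambda>b. zero_ind p (tree_sum (\<lambda>x. x) (left_edges @ right_edges @ cycle_edges) b))"
    unfolding set[symmetric] by (rule sum_PiE_eq_iterated_sum[OF distinct_xstrip(2)])
  also have "[\<dots> = (\<Sum>z1\<in>{0..<p}. \<Sum>z2\<in>{0..<p}. \<Sum>z3\<in>{0..<p}. \<Sum>z4\<in>{0..<p}. - (p\<^sup>2 * S z1 z2 z3 z4))] (mod p ^ 3)"
    unfolding tree_sum_xstrip S_def
    unfolding cycle_edges_def left_edges_def right_edges_def append.simps list.map prod.case iterated_sum.simps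
    by (simp only: fun_upd_apply doubleton_eq_iff xstrip_vertex.distinct simp_thms if_True if_False)
      (intro cong_sum count_both_gadgets)
  also have "(\<Sum>z1\<in>{0..<p}. \<Sum>z2\<in>{0..<p}. \<Sum>z3\<in>{0..<p}. \<Sum>z4\<in>{0..<p}. - (p\<^sup>2 * S z1 z2 z3 z4))
      = - (p\<^sup>2 * (\<Sum>z1\<in>{0..<p}. \<Sum>z2\<in>{0..<p}. \<Sum>z3\<in>{0..<p}. \<Sum>z4\<in>{0..<p}. S z1 z2 z3 z4))"
    by (simp only: sum_negf sum_distrib_left)
  also have "[\<dots> = - (p\<^sup>2 * (1 - zero_ind p 2))] (mod p ^ 3)"
  proof -
    have "[(\<Sum>z1\<in>{0..<p}. \<Sum>z2\<in>{0..<p}. \<Sum>z3\<in>{0..<p}. \<Sum>z4\<in>{0..<p}. S z1 z2 z3 z4)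
        = (\<Sum>z1\<in>{0..<p}. \<Sum>z2\<in>{0..<p}. \<Sum>z3\<in>{0..<p}. \<Sum>z4\<in>{0..<p}.
            (1 - zero_ind p (z2 * z3 * z4 + z1 * z3 * z4 + z1 * z2 * z4 + z1 * z2 * z3)) * (1 - zero_ind p (cycle_K z1 z2 z3 z4)))]
        (mod p)"
      unfolding S_def by (intro cong_sum count_gadget)
    from cong_trans[OF this count_cycle]
    have "p\<^sup>2 * p dvd p\<^sup>2 * ((\<Sum>z1\<in>{0..<p}. \<Sum>z2\<in>{0..<p}. \<Sum>z3\<in>{0..<p}. \<Sum>z4\<in>{0..<p}. S z1 z2 z3 z4) - (1 - zero_ind p 2))"
      unfolding cong_iff_dvd_diff by (rule mult_dvd_mono[OF dvd_refl])
    then show ?thesis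
      unfolding cong_iff_dvd_diff
      by (subst dvd_minus_iff[symmetric]) (simp add: power3_eq_cube power2_eq_square algebra_simps)
  qed
  finally show ?thesis .
qed

end

lemma point_count_xstrip_cong:
  assumes "prime p"
  shows "[int (point_count (UNIV :: xstrip_vertex set) xstrip_edges p)
    = (if p = 2 then 0 else - (int p)\<^sup>2)] (mod int p ^ 3)"
proof -
  interpret prime_modulus "int p" by unfold_locales (use assms in simp)
  let ?Q = "\<lambda>b :: xstrip_vertex set \<Rightarrow> int. \<Sum>T\<in>spanning_trees UNIV xstrip_edges. \<Prod>e\<in>xstrip_edges - T. b e"
  have fin: "finite xstrip_edges" by (simp add: xstrip_edges_def)
  have "point_count UNIV xstrip_edges p = card {b \<in> xstrip_edges \<rightarrow>\<^sub>E {0..<int p}. int p dvd ?Q b}"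
    unfolding point_count_def
    by (rule field.card_graph_hypersurface[OF GF_prime[OF assms] assms fin])
  also have "int \<dots> = (\<Sum>b\<in>xstrip_edges \<rightarrow>\<^sub>E {0..<int p}. zero_ind (int p) (?Q b))"
    using finite_PiE[OF fin, of "\<lambda>_. {0..<int p}"] by (simp add: zero_ind_def sum_of_bool_eq Int_def)
  finally have "[int (point_count UNIV xstrip_edges p) = - ((int p)\<^sup>2 * (1 - zero_ind (int p) 2))] (mod int p ^ 3)"
    using count_xstrip by simp
  moreover have "int p dvd 2 \<longleftrightarrow> p = 2"
    using assms primes_dvd_imp_eq[of p 2] by (auto simp flip: int_dvd_int_iff)
  ultimately show ?thesis by (cases "p = 2") (simp_all add: zero_ind_def)
qed

theorem theorem1p1:
  shows "\<not> (\<exists>P :: int poly. \<forall>q :: nat. primepow q \<longrightarrow>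
           int (point_count (UNIV :: xstrip_vertex set) xstrip_edges q) = poly P (int q))"
proof
  assume "\<exists>P :: int poly. \<forall>q :: nat. primepow q \<longrightarrow>
           int (point_count (UNIV :: xstrip_vertex set) xstrip_edges q) = poly P (int q)"
  then obtain P :: "int poly" where P: "\<And>q. primepow q \<Longrightarrow>
      int (point_count (UNIV :: xstrip_vertex set) xstrip_edges q) = poly P (int q)" by blast
  obtain c0 c1 c2 Q where "P = pCons c0 (pCons c1 (pCons c2 Q))" by (metis pCons_cases)
  then have poly: "poly P x = c0 + x * (c1 + x * (c2 + x * poly Q x))" for x by simp
  have odd: "int p ^ 3 dvd c0 + int p * (c1 + int p * (c2 + 1 + int p * poly Q (int p)))" if "prime p" "p \<noteq> 2" for p
    using point_count_xstrip_cong[OF that(1)] P[OF primepow_prime[OF that(1)]] that(2)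
    by (simp add: cong_iff_dvd_diff poly power2_eq_square algebra_simps)
  have zero: "c = 0" if c: "\<And>p. prime p \<Longrightarrow> p \<noteq> 2 \<Longrightarrow> int p dvd c" for c
  proof (rule ccontr)
    assume "c \<noteq> 0"
    obtain p where p: "prime p" "p > max 2 (nat \<bar>c\<bar>)" using bigger_prime by blast
    then have "int p \<le> \<bar>c\<bar>" using c[of p] \<open>c \<noteq> 0\<close> by (intro zdvd_imp_le) auto
    then show False using p by arith
  qed
  have "int p dvd c0" if "prime p" "p \<noteq> 2" for p
    using dvd_trans[OF dvd_power odd[OF that]] by (simp add: dvd_add_left_iff)
  then have c0: "c0 = 0" by (rule zero)
  have odd1: "(int p)\<^sup>2 dvd c1 + int p * (c2 + 1 + int p * poly Q (int p))" if "prime p" "p \<noteq> 2" for p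
    using odd[OF that] prime_gt_0_nat[OF that(1)] by (simp add: c0 power3_eq_cube power2_eq_square)
  have "int p dvd c1" if "prime p" "p \<noteq> 2" for p
    using dvd_trans[OF dvd_power odd1[OF that]] by (simp add: dvd_add_left_iff)
  then have c1: "c1 = 0" by (rule zero)
  have "int p dvd c2 + 1" if "prime p" "p \<noteq> 2" for p
    using odd1[OF that] prime_gt_0_nat[OF that(1)] by (simp add: c1 power2_eq_square dvd_add_left_iff)
  then have c2: "c2 = - 1" using zero[of "c2 + 1"] by simp
  \<comment> \<open>At \<open>q = 2\<close> the count is divisible by 8, but \<open>P(2)\<close> is \<open>- 4\<close> modulo 8.\<close>
  have "8 dvd 2 * (2 * (- 1 + 2 * poly Q 2))"
    using point_count_xstrip_cong[of 2] P[of 2] by (simp add: cong_iff_dvd_diff poly c0 c1 c2 primepow_prime)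
  then show False by presburger
qed

end
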